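(* Let $T$ be an ergodic measure-preserving map on the probability space $(X,\mathcal{A},\mu)$, $\theta\in(0,1]$, and $(A_l)_{l\ge 1}$ a sequence in $\mathcal{A}$ such that $0<\mu(A_l)\to 0$ and $A_l=A_l^{\bullet}\cup A_l^{\circ}$ (measurable and disjoint). Suppose that $\mu(\mu(A_l)\,\varphi_{A_l}\le t)\Longrightarrow 1-e^{-\theta t}$ as $l\to\infty$. For $l\ge 1$ let $\mathcal{V}_l$ be a family of probability measures on $(A_l,\mathcal{A}\cap A_l)$, and assume that $$\sup_{\nu_l\in\mathcal{V}_l}|\nu_l(A_l^{\circ})-\theta|\to 0\qquad\text{and}\qquad \mu(A_l)\sup_{\nu_l\in\mathcal{V}_l}\|1_{A_l^{\bullet}}\varphi_{A_l}\|_{L_\infty(\nu_l^{\bullet})}\to 0\qquad\text{as } l\to\infty,$$ and that for every $(k_l)\in\mathcal{K}(A_l)$, $$|\nu_l^{\circ}(\varphi_{A_l}=k_l)-\mu(\varphi_{A_l}=k_l)|=o(\mu(A_l))\qquad\text{as } l\to\infty,\ \text{uniformly in } (\nu_l)\in\textstyle\prod_{l\ge 1}\mathcal{V}_l.$$ Then the following hold. a) Suppose that for every $(k_l)\in\mathcal{K}(A_l)$, $$\nu_{l,\{\varphi_{A_l}=k_l\}}\circ T_{A_l}^{-1}\in\mathcal{V}_l\qquad\text{whenever } l\ge 1,\ \nu_l\in\mathcal{V}_l,\text{ and } \nu_l(\varphi_{A_l}=k_l)>0.$$ Then, for every $d\ge 1$ and $\delta\in(0,1]$, $$\nu_l\Big(\bigcap_{j=1}^d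 T_{A_l}^{-(j-1)}\{\varphi_{A_l}=k_l^{(j)}\}\Big)\sim\theta^{2d}\mu(A_l)^d\,e^{-\theta\mu(A_l)\sum_{j=1}^d k_l^{(j)}}$$ as $l\to\infty$, uniformly in $(\nu_l)\in\prod_{l\ge 1}\mathcal{V}_l$ and $(k_l^{(1)}),\ldots,(k_l^{(d)})\in\mathcal{K}_\delta(A_l)$. a') In the situation of a), let $d\geq 1$ and suppose, moreover, that $(C_l^{(1)})_{l\ge1},\ldots,(C_l^{(d)})_{l\ge1}$ are sequences with $C_l^{(j)}\in\mathcal{A}\cap A_l$ and $(c_l^{(1)})_{l\ge1},\ldots,(c_l^{(d)})_{l\ge1}$ are sequences in $(0,1]$ such that, for $1\le j\le d$, $$\nu_{l,C_l^{(j)}}\in\mathcal{V}_l\qquad\text{for } l\ge 1\text{ and } \nu_l\in\mathcal{V}_l\text{ with } \nu_l(C_l^{(j)})>0,$$ while, for every $(k_l)\in\mathcal{K}(A_l)$, $$\nu_{l,\{\varphi_{A_l}=k_l\}}\circ T_{A_l}^{-1}(C_l^{(j)})\sim c_l^{(j)}\qquad\text{as } l\to\infty,\ \text{uniformly in } (\nu_l)\in\textstyle\prod_{l\ge 1}\mathcal{V}_l.$$ Then, for every $\delta\in(0,1]$, $$\nu_l\Big(\bigcap_{j=1}^d T_{A_l}^{-(j-1)}\big(\{\varphi_{A_l}=k_l^{(j)}\}\cap T_{A_l}^{-1}C_l^{(j)}\big)\Big)\sim\theta^{2d}\mu(A_l)^d\Big(\prod_{j=1}^d c_l^{(j)}\Big)e^{-\theta\mu(A_l)\sum_{j=1}^d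 k_l^{(j)}}$$ as $l\to\infty$, uniformly in $(\nu_l)\in\prod_{l\ge 1}\mathcal{V}_l$ and $(k_l^{(1)}),\ldots,(k_l^{(d)})\in\mathcal{K}_\delta(A_l)$. b) In the situation of a), if $\mathcal{V}$ is a family of probability measures on $(X,\mathcal{A})$ which is LLT-uniform for $(A_l)$ and such that for every $(k_l)\in\mathcal{K}(A_l)$, $$\nu_{\{\varphi_{A_l}=k_l\}}\circ T_{A_l}^{-1}\in\mathcal{V}_l\qquad\text{for } l\ge 1\text{ and } \nu\in\mathcal{V}\text{ with } \nu(\varphi_{A_l}=k_l)>0,$$ then, for every $d\ge 1$ and $\delta\in(0,1]$, $$\nu\Big(\bigcap_{j=1}^d T_{A_l}^{-(j-1)}\{\varphi_{A_l}=k_l^{(j)}\}\Big)\sim\theta^{2d-1}\mu(A_l)^d\,e^{-\theta\mu(A_l)\sum_{j=1}^d k_l^{(j)}}$$ as $l\to\infty$, uniformly in $\nu\in\mathcal{V}$ and $(k_l^{(1)}),\ldots,(k_l^{(d)})\in\mathcal{K}_\delta(A_l)$. b') Under the assumptions of a') and b), if for every $(k_l)\in\mathcal{K}(A_l)$, $$\nu_{\{\varphi_{A_l}=k_l\}}\circ T_{A_l}^{-1}(C_l^{(1)})\sim c_l^{(1)}\qquad\text{as } l\to\infty,\ \text{uniformly in } \nu\in\mathcal{V},$$ then, for every $\delta\in(0,1]$, $$\nu\Big(\bigcap_{j=1}^d T_{A_l}^{-(j-1)}\big(\{\varphi_{A_l}=k_l^{(j)}\}\cap T_{A_l}^{-1}C_l^{(j)}\big)\Big)\sim\theta^{2d-1}\mu(A_l)^d\Big(\prod_{j=1}^d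 c_l^{(j)}\Big)e^{-\theta\mu(A_l)\sum_{j=1}^d k_l^{(j)}}$$ as $l\to\infty$, uniformly in $\nu\in\mathcal{V}$ and $(k_l^{(1)}),\ldots,(k_l^{(d)})\in\mathcal{K}_\delta(A_l)$.
   Context: For $A\in\mathcal{A}$ the hitting time function is $\varphi_A(x):=\inf\{n\ge 1: T^n x\in A\}\in\{1,2,\ldots,\infty\}$, $x\in X$; it is finite $\mu$-a.e. if $\mu(A)>0$. The first entrance map of $A$ is $T_A x:=T^{\varphi_A(x)}x\in A$, defined where $\varphi_A(x)<\infty$; $T_A^{-j}E$ is the set of points $x$ for which $T_A^j x$ is defined and lies in $E$. $F_l(t)\Rightarrow F(t)$ means $F_l(t)\to F(t)$ at every continuity point $t$ of $F$. For $\delta\in(0,1]$, $\mathcal{K}_\delta(A_l):=\{(k_l)_{l\ge 1}: k_l\in\mathbb{N},\ \delta\le \mu(A_l)k_l\le\delta^{-1}\text{ for } l\ge 1\}$, and $\mathcal{K}(A_l):=\bigcup_{\delta\in(0,1]}\mathcal{K}_\delta(A_l)$. For a measure $\nu$ and a measurable set $B$ with $\nu(B)>0$, $\nu_B$ (or $\nu_{l,B}$ if $\nu=\nu_l$) denotes $\nu$ conditioned on $B$, $\nu_B(E)=\nu(B\cap E)/\nu(B)$. For $\nu_l\in\mathcal{V}_l$, $\nu_l^{\bullet}:=\nu_{l,A_l^{\bullet}}$ if $\nu_l(A_l^{\bullet})>0$ and $\nu_l^{\bullet}:=0$ otherwise; $\nu_l^{\circ}:=\nu_{l,A_l^{\circ}}$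 if $\nu_l(A_l^{\circ})>0$ and $\nu_l^{\circ}:=0$ otherwise. An element $(\nu_l)$ of $\prod_{l\ge 1}\mathcal{V}_l$ is a sequence with $\nu_l\in\mathcal{V}_l$ for all $l$. Uniformity of $a_l=o(b_l)$ (resp. $a_l\sim b_l$) in some parameters means that for every $\varepsilon>0$ there is $l_0$ such that $|a_l|\le\varepsilon b_l$ (resp. $|a_l/b_l-1|\le\varepsilon$) for all $l\ge l_0$ and all admissible parameters. A family $\mathcal{V}$ of probability measures on $(X,\mathcal{A})$ is called LLT-uniform for $(A_l)$ if for every $(k_l)\in\mathcal{K}(A_l)$, $|\nu(\varphi_{A_l}=k_l)-\mu(\varphi_{A_l}=k_l)|=o(\mu(A_l))$ as $l\to\infty$, uniformly in $\nu\in\mathcal{V}$. *)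

theory Defs
  imports "HOL-Probability.Probability"
begin

definition measure_preserving_map :: "'a measure \<Rightarrow> ('a \<Rightarrow> 'a) \<Rightarrow> bool" where
  "measure_preserving_map M T \<longleftrightarrow> T \<in> measurable M M \<and> distr M M T = M"

definition ergodic_map :: "'a measure \<Rightarrow> ('a \<Rightarrow> 'a) \<Rightarrow> bool" where
  "ergodic_map M T \<longleftrightarrow>
     (\<forall>E\<in>sets M. T -` E \<inter> space M = E \<longrightarrow> measure M E = 0 \<or> measure M E = 1)"

text \<open>The infimum of the empty set is \<open>\<infinity>\<close> in \<^typ>\<open>enat\<close>.\<close>

definition hitting_time :: "('a \<Rightarrow> 'a) \<Rightarrow> 'a set \<Rightarrow> 'a \<Rightarrow> enat" where
  "hitting_time T A x = Inf (enat ` {n. 1 \<le> n \<and> (T ^^ n) x \<in> A})"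

text \<open>The event that the hitting time equals \<open>k\<close>. The measure argument only supplies the
  underlying space, which is \<open>X\<close> for a measure on \<open>X\<close>, and \<open>A\<close> for a measure on the trace
  of the sigma algebra on \<open>A\<close>.\<close>

definition hit_at :: "'a measure \<Rightarrow> ('a \<Rightarrow> 'a) \<Rightarrow> 'a set \<Rightarrow> nat \<Rightarrow> 'a set" where
  "hit_at M T A k = {x \<in> space M. hitting_time T A x = enat k}"

text \<open>The value of the first entrance map is meaningful only where the hitting time is finite;
  the definitions below which use this map never refer to it elsewhere.\<close>

definition first_entrance :: "('a \<Rightarrow> 'a) \<Rightarrow> 'a set \<Rightarrow> 'a \<Rightarrow> 'a" where
  "first_entrance T A x = (T ^^ the_enat (hitting_time T A x)) x"

text \<open>The preimage of \<open>E\<close> under the first entrance map, as a partial map. Its \<open>j\<close>-fold iterate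
  \<open>entrance_vimage M T A ^^ j\<close> maps \<open>E\<close> to the set of points at which the \<open>j\<close>-th iterate
  of the first entrance map is defined with value in \<open>E\<close>.\<close>

definition entrance_vimage :: "'a measure \<Rightarrow> ('a \<Rightarrow> 'a) \<Rightarrow> 'a set \<Rightarrow> 'a set \<Rightarrow> 'a set" where
  "entrance_vimage M T A E =
     {x \<in> space M. hitting_time T A x < \<infinity> \<and> first_entrance T A x \<in> E}"

text \<open>The image of \<open>\<nu>\<close> under the first entrance map, as a measure on the trace of \<open>M\<close> on \<open>A\<close>;
  \<open>\<nu>\<close> is first restricted to the domain of that map.\<close>

definition entrance_distr ::
  "'a measure \<Rightarrow> ('a \<Rightarrow> 'a) \<Rightarrow> 'a set \<Rightarrow> 'a measure \<Rightarrow> 'a measure" where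
  "entrance_distr M T A \<nu> =
     distr (restrict_space \<nu> {x \<in> space \<nu>. hitting_time T A x < \<infinity>})
       (restrict_space M A) (first_entrance T A)"

text \<open>Conditioning on \<open>B\<close>, with the zero measure as the result if \<open>B\<close> is a null set.\<close>

definition cond_or_zero :: "'a measure \<Rightarrow> 'a set \<Rightarrow> 'a measure" where
  "cond_or_zero \<nu> B = (if 0 < measure \<nu> B then uniform_measure \<nu> B else null_measure \<nu>)"

definition time_seqs_delta :: "'a measure \<Rightarrow> (nat \<Rightarrow> 'a set) \<Rightarrow> real \<Rightarrow> (nat \<Rightarrow> nat) set" where
  "time_seqs_delta M A \<delta> =
     {k. \<forall>l. \<delta> \<le> measure M (A l) * real (k l) \<and> measure M (A l) * real (k l) \<le> inverse \<delta>}"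

definition time_seqs :: "'a measure \<Rightarrow> (nat \<Rightarrow> 'a set) \<Rightarrow> (nat \<Rightarrow> nat) set" where
  "time_seqs M A = (\<Union>\<delta>\<in>{0<..1}. time_seqs_delta M A \<delta>)"

text \<open>Landau relations along the sequence index \<open>l\<close>, uniformly in a parameter \<open>p\<close>.\<close>

definition unif_smallo :: "'p set \<Rightarrow> ('p \<Rightarrow> nat \<Rightarrow> real) \<Rightarrow> ('p \<Rightarrow> nat \<Rightarrow> real) \<Rightarrow> bool" where
  "unif_smallo P a b \<longleftrightarrow> (\<forall>\<epsilon>>0. \<exists>l0. \<forall>l\<ge>l0. \<forall>p\<in>P. \<bar>a p l\<bar> \<le> \<epsilon> * b p l)"

definition unif_asymp :: "'p set \<Rightarrow> ('p \<Rightarrow> nat \<Rightarrow> real) \<Rightarrow> ('p \<Rightarrow> nat \<Rightarrow> real) \<Rightarrow> bool" where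
  "unif_asymp P a b \<longleftrightarrow> (\<forall>\<epsilon>>0. \<exists>l0. \<forall>l\<ge>l0. \<forall>p\<in>P. \<bar>a p l / b p l - 1\<bar> \<le> \<epsilon>)"

definition LLT_uniform ::
  "'a measure \<Rightarrow> ('a \<Rightarrow> 'a) \<Rightarrow> (nat \<Rightarrow> 'a set) \<Rightarrow> 'a measure set \<Rightarrow> bool" where
  "LLT_uniform M T A W \<longleftrightarrow>
     (\<forall>k\<in>time_seqs M A. unif_smallo W
        (\<lambda>\<nu> l. \<bar>measure \<nu> (hit_at \<nu> T (A l) (k l)) - measure M (hit_at M T (A l) (k l))\<bar>)
        (\<lambda>\<nu> l. measure M (A l)))"

text \<open>Conditioning the members of \<open>U l\<close> on a hitting time and applying the first entrance map
  yields members of \<open>V l\<close>.\<close>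

definition entrance_closed ::
  "'a measure \<Rightarrow> ('a \<Rightarrow> 'a) \<Rightarrow> (nat \<Rightarrow> 'a set) \<Rightarrow> (nat \<Rightarrow> 'a measure set)
    \<Rightarrow> (nat \<Rightarrow> 'a measure set) \<Rightarrow> bool" where
  "entrance_closed M T A U V \<longleftrightarrow>
     (\<forall>k\<in>time_seqs M A. \<forall>l. \<forall>\<nu>\<in>U l. 0 < measure \<nu> (hit_at \<nu> T (A l) (k l)) \<longrightarrow>
        entrance_distr M T (A l) (uniform_measure \<nu> (hit_at \<nu> T (A l) (k l))) \<in> V l)"

text \<open>If the conditioning event is a null set, \<^const>\<open>uniform_measure\<close> is the zero measure. Under the
  local limit assumptions with which this is combined, the event has positive measure for all
  large \<open>l\<close>, uniformly in \<open>\<nu>\<close>, so that this convention is immaterial.\<close>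

definition entrance_asymp ::
  "'a measure \<Rightarrow> ('a \<Rightarrow> 'a) \<Rightarrow> (nat \<Rightarrow> 'a set) \<Rightarrow> (nat \<Rightarrow> 'a measure) set
    \<Rightarrow> (nat \<Rightarrow> 'a set) \<Rightarrow> (nat \<Rightarrow> real) \<Rightarrow> bool" where
  "entrance_asymp M T A P C c \<longleftrightarrow>
     (\<forall>k\<in>time_seqs M A. unif_asymp P
        (\<lambda>\<nu> l. measure (entrance_distr M T (A l)
                  (uniform_measure (\<nu> l) (hit_at (\<nu> l) T (A l) (k l)))) (C l))
        (\<lambda>\<nu> l. c l))"

definition admissible_targets ::
  "'a measure \<Rightarrow> ('a \<Rightarrow> 'a) \<Rightarrow> (nat \<Rightarrow> 'a set) \<Rightarrow> (nat \<Rightarrow> 'a measure set)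
    \<Rightarrow> nat \<Rightarrow> (nat \<Rightarrow> nat \<Rightarrow> 'a set) \<Rightarrow> (nat \<Rightarrow> nat \<Rightarrow> real) \<Rightarrow> bool" where
  "admissible_targets M T A V d C c \<longleftrightarrow>
     (\<forall>j\<in>{1..d}.
        (\<forall>l. C j l \<in> sets (restrict_space M (A l))) \<and>
        (\<forall>l. 0 < c j l \<and> c j l \<le> 1) \<and>
        (\<forall>l. \<forall>\<nu>\<in>V l. 0 < measure \<nu> (C j l) \<longrightarrow> uniform_measure \<nu> (C j l) \<in> V l) \<and>
        entrance_asymp M T A (Pi UNIV V) (C j) (c j))"

text \<open>In the following two events, \<open>n j\<close> is the time between the visits \<open>j - 1\<close> and \<open>j\<close>
  to \<open>A\<close>; in the second one, visit \<open>j\<close> moreover takes place in \<open>D j\<close>.\<close>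

definition hits_event :: "'a measure \<Rightarrow> ('a \<Rightarrow> 'a) \<Rightarrow> 'a set \<Rightarrow> nat \<Rightarrow> (nat \<Rightarrow> nat) \<Rightarrow> 'a set" where
  "hits_event M T A d n =
     (\<Inter>j\<in>{1..d}. (entrance_vimage M T A ^^ (j - 1)) (hit_at M T A (n j)))"

definition target_hits_event ::
  "'a measure \<Rightarrow> ('a \<Rightarrow> 'a) \<Rightarrow> 'a set \<Rightarrow> nat \<Rightarrow> (nat \<Rightarrow> nat) \<Rightarrow> (nat \<Rightarrow> 'a set) \<Rightarrow> 'a set" where
  "target_hits_event M T A d n D =
     (\<Inter>j\<in>{1..d}. (entrance_vimage M T A ^^ (j - 1))
        (hit_at M T A (n j) \<inter> entrance_vimage M T A (D j)))"

end

theory Submission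
  imports Defs
begin

text \<open>For the invariant measure the densities \<open>\<mu>(\<phi> = k)\<close> are nonincreasing in \<open>k \<ge> 1\<close>, because
  \<open>{\<phi> = k + 1} \<subseteq> T\<inverse>{\<phi> = k}\<close>. Hence convergence in law of the rescaled hitting times to the exponential
  distribution gives the local limit \<open>\<mu>(\<phi> = k) \<sim> \<theta> \<mu>(A) e\<close>, where \<open>e = exp (- \<theta> \<mu>(A) k)\<close>. A measure in \<open>V\<close>
  puts mass about \<open>\<theta>\<close> on \<open>Ao\<close>, where it has the same local limit, and on \<open>Ab\<close> the return is too
  early to contribute, so that \<open>\<nu>(\<phi> = k) \<sim> \<theta>\<^sup>2 \<mu>(A) e\<close>. Conditioning on the first return time and on the
  target of the first return, and moving forward by the first entrance map, stays inside \<open>V\<close>, so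
  that the probability of \<open>d\<close> prescribed returns factorizes, by induction on \<open>d\<close>. Uniformity is
  obtained by working throughout with arbitrary sequences of measures and times.\<close>

subsection \<open>Hitting times and first entrance\<close>

text \<open>Brings measures on the whole space into the form
  \<open>sets N = sets (restrict_space M (space N))\<close>, so that the same lemmas serve measures
  on \<open>X\<close> and measures on \<open>A l\<close>.\<close>

lemma sets_restrict_space_space: "sets (restrict_space M (space M)) = sets M"
  by (auto simp: sets_restrict_space_iff dest: subsetD[OF sets.sets_into_space])

text \<open>The infimum of a nonempty set in \<open>enat\<close> is attained. The right-hand side
  involves only finitely many iterates, which gives measurability.\<close>

lemma hitting_time_eq_enat_iff:
  "hitting_time T A x = enat k \<longleftrightarrow>
     1 \<le> k \<and> (T ^^ k) x \<in> A \<and> (\<forall>j. 1 \<le> j \<and> j < k \<longrightarrow> (T ^^ j) x \<notin> A)"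
  (is "_ \<longleftrightarrow> ?first k")
proof
  let ?S = "{n. 1 \<le> n \<and> (T ^^ n) x \<in> A}"
  assume *: "hitting_time T A x = enat k"
  \<comment> \<open>The infimum of the empty set is infinite, so a finite value forces a
    visit.\<close>
  have "?S \<noteq> {}"
  proof
    assume "?S = {}"
    with * show False unfolding hitting_time_def by (simp only: image_empty) (simp add: Inf_enat_def)
  qed
  then have "enat ` ?S \<noteq> {}" by blast
  then have "enat k \<in> enat ` ?S"
    using * unfolding hitting_time_def by (metis Inf_enat_def LeastI ex_in_conv)
  moreover have "k \<le> j" if "j \<in> ?S" for j
  proof -
    have "hitting_time T A x \<le> enat j"
      unfolding hitting_time_def using that by (intro Inf_lower) auto
    then show ?thesis using * by simp
  qed
  ultimately show "?first k" by fastforce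
next
  assume *: "?first k"
  show "hitting_time T A x = enat k"
    unfolding hitting_time_def
  proof (rule Inf_eqI)
    fix y assume "\<And>i. i \<in> enat ` {n. 1 \<le> n \<and> (T ^^ n) x \<in> A} \<Longrightarrow> y \<le> i"
    then show "y \<le> enat k" using * by auto
  next
    fix i assume "i \<in> enat ` {n. 1 \<le> n \<and> (T ^^ n) x \<in> A}"
    then show "enat k \<le> i" using * by (auto simp: not_less[symmetric])
  qed
qed

lemma first_entrance_mem: "hitting_time T A x = enat k \<Longrightarrow> first_entrance T A x \<in> A"
  by (simp add: first_entrance_def) (simp add: hitting_time_eq_enat_iff)

lemma first_entrance_in_space:
  assumes "T \<in> measurable M M" "x \<in> space M"
  shows "first_entrance T A x \<in> space M"
  using assms measurable_space[OF measurable_compose_n[OF assms(1)]]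
  by (simp add: first_entrance_def)

lemma sets_hit_at:
  assumes [measurable]: "T \<in> measurable M M" "A \<in> sets M"
  shows "hit_at M T A k \<in> sets M"
proof -
  have [measurable]: "(T ^^ n) \<in> measurable M M" for n by (rule measurable_compose_n) simp
  have "hit_at M T A k = {x \<in> space M. 1 \<le> k \<and> (T ^^ k) x \<in> A \<and> (\<forall>j\<in>{1..<k}. (T ^^ j) x \<notin> A)}"
    by (auto simp: hit_at_def hitting_time_eq_enat_iff)
  also have "\<dots> \<in> sets M" by measurable
  finally show ?thesis .
qed

text \<open>Where the hitting time is \<open>k\<close>, the first entrance map is the fixed iterate
  \<open>T ^^ k\<close>; a countable union removes the dependence of the exponent on the
  point.\<close>

lemma entrance_vimage_eq:
  "entrance_vimage M T A E = (\<Union>k. hit_at M T A k \<inter> ((T ^^ k) -` E \<inter> space M))"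
  by (auto simp: entrance_vimage_def hit_at_def first_entrance_def elim!: less_infinityE)

text \<open>Measurability is asked of \<open>E \<inter> space M\<close> because the event for zero
  returns is an empty intersection, that is \<open>UNIV\<close>.\<close>

lemma sets_entrance_vimage:
  assumes "T \<in> measurable M M" "A \<in> sets M" "E \<inter> space M \<in> sets M"
  shows "entrance_vimage M T A E \<in> sets M"
proof -
  have T: "(T ^^ n) \<in> measurable M M" for n using assms(1) by (rule measurable_compose_n)
  have "(T ^^ k) -` E \<inter> space M = (T ^^ k) -` (E \<inter> space M) \<inter> space M" for k
    using measurable_space[OF T] by blast
  then have "(T ^^ k) -` E \<inter> space M \<in> sets M" for k
    using measurable_sets[OF T assms(3)] by metis
  then show ?thesis
    unfolding entrance_vimage_eq using sets_hit_at[OF assms(1,2)]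
    by (intro sets.countable_UN image_subsetI) (rule sets.Int)
qed

text \<open>Entrance preimages commute with nonempty intersections, so the conditions on visits 2 to
  \<open>d + 1\<close> are those on visits 1 to \<open>d\<close> seen from the first entrance point.
  This recursion drives the induction on \<open>d\<close>.\<close>

lemma target_hits_event_Suc:
  "target_hits_event M T A (Suc d) n D =
     hit_at M T A (n 1) \<inter> entrance_vimage M T A (D 1)
       \<inter> entrance_vimage M T A (target_hits_event M T A d (n \<circ> Suc) (D \<circ> Suc))"
proof -
  define B where "B j = (entrance_vimage M T A ^^ (j - 1))
        (hit_at M T A (n j) \<inter> entrance_vimage M T A (D j))" for j
  define B' where "B' j = (entrance_vimage M T A ^^ (j - 1))
        (hit_at M T A (n (Suc j)) \<inter> entrance_vimage M T A (D (Suc j)))" for j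
  have S: "B (Suc j) = entrance_vimage M T A (B' j)" if "1 \<le> j" for j
    using that by (cases j) (simp_all add: B_def B'_def)
  have "(\<Inter>j\<in>{1..Suc d}. B j) = B 1 \<inter> (\<Inter>j\<in>{1..d}. B (Suc j))"
  proof -
    have "{1..Suc d} = insert 1 (Suc ` {1..d})"
      by (simp add: image_Suc_atLeastAtMost atLeastAtMost_insertL del: image_insert)
    then have "(\<Inter>j\<in>{1..Suc d}. B j) = (\<Inter>j\<in>insert 1 (Suc ` {1..d}). B j)"
      by (rule arg_cong)
    then show ?thesis by (simp only: INT_insert image_image)
  qed
  also have "\<dots> = B 1 \<inter> (\<Inter>j\<in>{1..d}. entrance_vimage M T A (B' j))"
    using S by auto
  \<comment> \<open>For \<open>d = 0\<close> the inner intersection is \<open>UNIV\<close>, whose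
    entrance preimage is only the set of finite hitting times; \<open>B 1\<close> is contained in
    that set.\<close>
  also have "\<dots> = B 1 \<inter> entrance_vimage M T A (\<Inter>j\<in>{1..d}. B' j)"
    by (auto simp: entrance_vimage_def B_def hit_at_def)
  finally show ?thesis
    by (simp add: target_hits_event_def B_def B'_def)
qed

lemma sets_target_hits_event:
  assumes "T \<in> measurable M M" "A \<in> sets M" "\<And>j. j \<in> {1..d} \<Longrightarrow> D j \<in> sets M"
  shows "target_hits_event M T A d n D \<inter> space M \<in> sets M"
  using assms(3)
proof (induction d arbitrary: n D)
  case 0
  then show ?case by (simp add: target_hits_event_def)
next
  case (Suc d)
  have "target_hits_event M T A d (n \<circ> Suc) (D \<circ> Suc) \<inter> space M \<in> sets M"
    using Suc.prems by (intro Suc.IH) auto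
  moreover have "D 1 \<in> sets M" using Suc.prems by auto
  ultimately have "target_hits_event M T A (Suc d) n D \<in> sets M"
    unfolding target_hits_event_Suc using assms(1,2)
    by (intro sets.Int[of "_ \<inter> _"] sets.Int[of "hit_at _ _ _ _"] sets_entrance_vimage sets_hit_at) auto
  then show ?case by auto
qed

text \<open>The first entrance point lies in \<open>A\<close> automatically. Hence the statements
  without targets are the special case of the target \<open>A\<close>.\<close>

lemma hits_event_eq_target_hits_event:
  "hits_event M T A d n = target_hits_event M T A d n (\<lambda>j. A)"
proof -
  have "hit_at M T A k \<inter> entrance_vimage M T A A = hit_at M T A k" for k
    by (auto simp: hit_at_def entrance_vimage_def first_entrance_mem)
  then show ?thesis by (simp add: hits_event_def target_hits_event_def)
qed

text \<open>If uniformity fails, a violating parameter exists at arbitrarily large indices, and a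
  sequence through these parameters contradicts the hypothesis. Limits along arbitrary sequences of
  parameters therefore suffice.\<close>

lemma unif_asympI_sequences:
  assumes "\<And>x. (\<And>l. x l \<in> P) \<Longrightarrow> (\<lambda>l. a (x l) l / b (x l) l) \<longlonglongrightarrow> 1"
  shows "unif_asymp P a b"
proof (rule ccontr)
  assume "\<not> unif_asymp P a b"
  then obtain \<epsilon> where e: "\<epsilon> > 0"
    and bad: "\<And>l0. \<exists>l\<ge>l0. \<exists>p\<in>P. \<not> \<bar>a p l / b p l - 1\<bar> \<le> \<epsilon>"
    unfolding unif_asymp_def by meson
  obtain p0 where p0: "p0 \<in> P" using bad by blast
  define Q where "Q l p \<longleftrightarrow> p \<in> P \<and> \<not> \<bar>a p l / b p l - 1\<bar> \<le> \<epsilon>" for l p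
  \<comment> \<open>\<open>p0\<close> is a filler at the indices that have no violating
    parameter.\<close>
  define x where "x l = (if \<exists>p. Q l p then SOME p. Q l p else p0)" for l
  have x: "Q l (x l)" if "\<exists>p. Q l p" for l
    using that by (simp add: x_def someI_ex)
  have "x l \<in> P" for l
    using x[of l] p0 by (cases "\<exists>p. Q l p") (auto simp: Q_def x_def)
  from LIMSEQ_D[OF assms[of x, OF this] e] obtain l0
    where "\<And>l. l \<ge> l0 \<Longrightarrow> \<bar>a (x l) l / b (x l) l - 1\<bar> < \<epsilon>" by auto
  moreover obtain l where "l \<ge> l0" "\<exists>p. Q l p" using bad[of l0] by (auto simp: Q_def)
  ultimately show False using x[of l] by (fastforce simp: Q_def)
qed

text \<open>The iterate \<open>j\<close> of \<open>T x\<close> is the iterate \<open>j + 1\<close>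
  of \<open>x\<close>; dropping the condition at time 1 leaves an inclusion. At \<open>n = 0\<close>
  it could fail, since no hitting time is 0.\<close>

lemma hit_at_Suc_subset:
  assumes "T \<in> measurable M M" "1 \<le> n"
  shows "hit_at M T A (Suc n) \<subseteq> T -` hit_at M T A n \<inter> space M"
proof
  fix x assume "x \<in> hit_at M T A (Suc n)"
  then have x: "x \<in> space M" and S: "(T ^^ Suc n) x \<in> A"
    and lt: "\<And>j. 1 \<le> j \<Longrightarrow> j < Suc n \<Longrightarrow> (T ^^ j) x \<notin> A"
    by (auto simp: hit_at_def hitting_time_eq_enat_iff)
  have "(T ^^ n) (T x) \<in> A" using S by (simp add: funpow_swap1)
  moreover have "(T ^^ j) (T x) \<notin> A" if "1 \<le> j" "j < n" for j
    using lt[of "Suc j"] that by (simp add: funpow_swap1)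
  ultimately show "x \<in> T -` hit_at M T A n \<inter> space M"
    using x assms measurable_space[OF assms(1) x] by (simp add: hit_at_def hitting_time_eq_enat_iff)
qed

subsection \<open>The local limit for the invariant measure\<close>

locale measure_preserving_system = prob_space M for M :: "'a measure" +
  fixes T :: "'a \<Rightarrow> 'a"
  assumes mp: "measure_preserving_map M T"
begin

lemma measurable_T: "T \<in> measurable M M"
  using mp by (simp add: measure_preserving_map_def)

lemma measure_vimage_T: "B \<in> sets M \<Longrightarrow> measure M (T -` B \<inter> space M) = measure M B"
  using mp measure_distr[OF measurable_T, of B] by (simp add: measure_preserving_map_def)

context
  fixes A assumes A: "A \<in> sets M"
begin

lemma measure_hit_at_antimono:
  assumes "1 \<le> m" "m \<le> n"
  shows "measure M (hit_at M T A n) \<le> measure M (hit_at M T A m)"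
  using assms(2)
proof (induction rule: dec_induct)
  case (step n)
  have "measure M (hit_at M T A (Suc n)) \<le> measure M (T -` hit_at M T A n \<inter> space M)"
    using hit_at_Suc_subset[OF measurable_T, of n] step.hyps assms(1)
      measurable_sets[OF measurable_T sets_hit_at[OF measurable_T A]]
    by (intro finite_measure_mono) auto
  also have "\<dots> = measure M (hit_at M T A n)"
    by (rule measure_vimage_T) (rule sets_hit_at[OF measurable_T A])
  finally show ?case using step.IH by simp
qed simp

text \<open>The increment \<open>F b - F a\<close> is the sum of \<open>g\<close> over the integers
  \<open>i\<close> with \<open>a < m * i \<le> b\<close>. Their number times \<open>m\<close>
  differs from \<open>b - a\<close> by at most \<open>m\<close>, and by monotonicity each summand is
  at least \<open>g n\<close> if \<open>m * n\<close> is beyond \<open>b\<close>, and at most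
  \<open>g n\<close> if \<open>m * n\<close> is before \<open>a\<close>.\<close>

lemma measure_scaled_hitting_time_diff:
  fixes m a b :: real
  assumes m: "0 < m" and ab: "0 \<le> a" "a < b"
  defines "F \<equiv> \<lambda>t. measure M {x \<in> space M. ereal m * ereal_of_enat (hitting_time T A x) \<le> ereal t}"
  defines "g \<equiv> \<lambda>n. measure M (hit_at M T A n)"
  shows "\<And>n. b \<le> m * real n \<Longrightarrow> (b - a - m) * g n \<le> m * (F b - F a)"
    and "\<And>n. 1 \<le> n \<Longrightarrow> m * real n \<le> a \<Longrightarrow> m * (F b - F a) \<le> (b - a + m) * g n"
proof -
  define N where "N = {nat \<lfloor>a / m\<rfloor> <.. nat \<lfloor>b / m\<rfloor>}"
  have N_iff: "n \<in> N \<longleftrightarrow> a < m * real n \<and> m * real n \<le> b" for n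
  proof -
    have "nat \<lfloor>a / m\<rfloor> < n \<longleftrightarrow> a / m < real n"
      using ab m by (auto simp: nat_less_iff floor_less_iff)
    moreover have "n \<le> nat \<lfloor>b / m\<rfloor> \<longleftrightarrow> real n \<le> b / m"
      using ab m by (auto simp: nat_le_iff le_nat_iff le_floor_iff)
    ultimately show ?thesis using m by (auto simp: N_def field_simps)
  qed
  define S where "S t = {x \<in> space M. ereal m * ereal_of_enat (hitting_time T A x) \<le> ereal t}" for t
  have S_eq: "S t = (\<Union>n\<in>{n. m * real n \<le> t}. hit_at M T A n)" for t
  proof (intro set_eqI)
    fix x show "x \<in> S t \<longleftrightarrow> x \<in> (\<Union>n\<in>{n. m * real n \<le> t}. hit_at M T A n)"
      using m by (cases "hitting_time T A x") (auto simp: S_def hit_at_def)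
  qed
  have S_sets: "S t \<in> sets M" for t
    unfolding S_eq by (intro sets.countable_UN') (auto intro: sets_hit_at[OF measurable_T A])
  have disj: "disjoint_family_on (hit_at M T A) I" for I
    by (auto simp: disjoint_family_on_def hit_at_def)
  have "F b - F a = measure M (S b - S a)"
  proof -
    have "S a \<subseteq> S b"
      using ab by (auto simp: S_def intro: order.trans)
    then show ?thesis
      using finite_measure_Diff[OF S_sets S_sets, of a b] unfolding F_def S_def by simp
  qed
  also have "S b - S a = (\<Union>n\<in>N. hit_at M T A n)"
    using ab by (auto simp: S_eq N_iff hit_at_def not_le)
  also have "measure M \<dots> = (\<Sum>n\<in>N. g n)"
    unfolding g_def by (rule finite_measure_finite_Union)
      (auto simp: N_def disj intro: sets_hit_at[OF measurable_T A])
  finally have F: "F b - F a = (\<Sum>n\<in>N. g n)" .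
  have g0: "0 \<le> g n" for n by (simp add: g_def)
  \<comment> \<open>Each floor is off by less than 1, so the count is within 1 of
    \<open>(b - a) / m\<close>.\<close>
  have card: "b - a - m \<le> m * card N" "m * card N \<le> b - a + m"
  proof -
    have le: "\<lfloor>a / m\<rfloor> \<le> \<lfloor>b / m\<rfloor>" "0 \<le> \<lfloor>a / m\<rfloor>"
      using ab m by (auto intro!: floor_mono divide_right_mono)
    then have "real (card N) = of_int \<lfloor>b / m\<rfloor> - of_int \<lfloor>a / m\<rfloor>"
      by (simp add: N_def of_nat_diff nat_mono del: zero_le_floor)
    then have "b / m - a / m - 1 \<le> card N" "card N \<le> b / m - a / m + 1"
      by linarith+
    then show "b - a - m \<le> m * card N" "m * card N \<le> b - a + m"
      using m by (simp_all add: field_simps)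
  qed
  show "(b - a - m) * g n \<le> m * (F b - F a)" if n: "b \<le> m * real n" for n
  proof -
    \<comment> \<open>As \<open>a \<ge> 0\<close>, the indices in \<open>N\<close> are at least 1,
      where monotonicity starts.\<close>
    have "g n \<le> g i" if "i \<in> N" for i
    proof -
      have "m * real i \<le> m * real n" "0 < m * real i" using that n ab by (auto simp: N_iff)
      then show ?thesis using m unfolding g_def
        by (intro measure_hit_at_antimono) (auto simp: zero_less_mult_iff)
    qed
    then have "card N * g n \<le> F b - F a"
      unfolding F using sum_bounded_below[of N "g n" g] by simp
    then have "m * card N * g n \<le> m * (F b - F a)"
      using m by (simp add: mult.assoc)
    moreover have "(b - a - m) * g n \<le> m * card N * g n"
      using card(1) g0 by (rule mult_right_mono)
    ultimately show ?thesis by simp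
  qed
  show "m * (F b - F a) \<le> (b - a + m) * g n" if n: "1 \<le> n" "m * real n \<le> a" for n
  proof -
    have "g i \<le> g n" if "i \<in> N" for i
    proof -
      have "m * real n \<le> m * real i" using that n by (auto simp: N_iff)
      then show ?thesis using m n unfolding g_def
        by (intro measure_hit_at_antimono) auto
    qed
    then have "F b - F a \<le> card N * g n"
      unfolding F using sum_bounded_above[of N g "g n"] by simp
    then have "m * (F b - F a) \<le> m * card N * g n"
      using m by (simp add: mult.assoc)
    moreover have "m * card N * g n \<le> (b - a + m) * g n"
      using card(2) g0 by (rule mult_right_mono)
    ultimately show ?thesis by simp
  qed
qed

end

end

text \<open>Both follow from \<open>1 + x \<le> exp x\<close>. For \<open>a < b\<close> they place
  the mean of the exponential density over the interval between its values at the end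
  points.\<close>

lemma exp_decay_diff_bounds:
  fixes \<theta> a b :: real
  shows "exp (- \<theta> * a) - exp (- \<theta> * b) \<le> \<theta> * (b - a) * exp (- \<theta> * a)"
    and "\<theta> * (b - a) * exp (- \<theta> * b) \<le> exp (- \<theta> * a) - exp (- \<theta> * b)"
proof -
  have "exp (- \<theta> * b) = exp (- \<theta> * a) * exp (- \<theta> * (b - a))"
    by (simp add: exp_add[symmetric] algebra_simps)
  moreover have "1 - \<theta> * (b - a) \<le> exp (- \<theta> * (b - a))"
    using exp_ge_add_one_self[of "- \<theta> * (b - a)"] by simp
  then have "exp (- \<theta> * a) * (1 - \<theta> * (b - a)) \<le> exp (- \<theta> * a) * exp (- \<theta> * (b - a))"
    by (rule mult_left_mono) simp
  ultimately show "exp (- \<theta> * a) - exp (- \<theta> * b) \<le> \<theta> * (b - a) * exp (- \<theta> * a)"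
    by (simp add: algebra_simps)
  have "exp (- \<theta> * a) = exp (- \<theta> * b) * exp (\<theta> * (b - a))"
    by (simp add: exp_add[symmetric] algebra_simps)
  moreover have "exp (- \<theta> * b) * (1 + \<theta> * (b - a)) \<le> exp (- \<theta> * b) * exp (\<theta> * (b - a))"
    using exp_ge_add_one_self[of "\<theta> * (b - a)"] by (rule mult_left_mono) simp
  ultimately show "\<theta> * (b - a) * exp (- \<theta> * b) \<le> exp (- \<theta> * a) - exp (- \<theta> * b)"
    by (simp add: algebra_simps)
qed

lemma time_seqs_delta_bounds:
  assumes "k \<in> time_seqs_delta M A \<delta>"
  shows "\<delta> \<le> measure M (A l) * real (k l)" "measure M (A l) * real (k l) \<le> inverse \<delta>"
  using assms by (auto simp: time_seqs_delta_def)

text \<open>Since the densities are nonincreasing, convergence in law to the exponential distribution,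
  whose density is continuous, upgrades to a local limit theorem.\<close>

lemma (in measure_preserving_system) hitting_time_local_limit:
  fixes A :: "nat \<Rightarrow> 'a set" and \<theta> \<delta> :: real
  assumes A: "\<And>l. A l \<in> sets M" and pos: "\<And>l. 0 < measure M (A l)"
    and lim: "(\<lambda>l. measure M (A l)) \<longlonglongrightarrow> 0"
    and conv: "weak_conv
           (\<lambda>l t. measure M {x \<in> space M.
              ereal (measure M (A l)) * ereal_of_enat (hitting_time T (A l) x) \<le> ereal t})
           (\<lambda>t. if 0 \<le> t then 1 - exp (- \<theta> * t) else 0)"
    and \<delta>: "0 < \<delta>" and k: "k \<in> time_seqs_delta M A \<delta>"
  shows "(\<lambda>l. measure M (hit_at M T (A l) (k l)) / measure M (A l)
            - \<theta> * exp (- \<theta> * measure M (A l) * real (k l))) \<longlonglongrightarrow> 0"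
proof (rule ccontr)
  define m where "m l = measure M (A l)" for l
  define G where "G l = measure M (hit_at M T (A l) (k l)) / m l" for l
  define F where "F l t = measure M {x \<in> space M.
              ereal (measure M (A l)) * ereal_of_enat (hitting_time T (A l) x) \<le> ereal t}" for l t
  have m: "0 < m l" for l using pos by (simp add: m_def)
  \<comment> \<open>Weak convergence speaks only of continuity points; near \<open>t > 0\<close> the
    limit function agrees with a continuous one.\<close>
  have F_lim: "(\<lambda>l. F l t) \<longlonglongrightarrow> 1 - exp (- \<theta> * t)" if "0 < t" for t
  proof -
    have "isCont (\<lambda>t. if 0 \<le> t then 1 - exp (- \<theta> * t) else 0) t
      \<longleftrightarrow> isCont (\<lambda>t. 1 - exp (- \<theta> * t)) t"
    proof (rule isCont_cong)
      have "eventually (\<lambda>t. t \<in> {0<..}) (nhds t)"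
        using that by (intro eventually_nhds_in_open) auto
      then show "eventually (\<lambda>t. (if 0 \<le> t then 1 - exp (- \<theta> * t) else 0) = 1 - exp (- \<theta> * t)) (nhds t)"
        by eventually_elim auto
    qed
    then show ?thesis
      using conv that unfolding weak_conv_def F_def by fastforce
  qed
  assume "\<not> (\<lambda>l. measure M (hit_at M T (A l) (k l)) / measure M (A l)
            - \<theta> * exp (- \<theta> * measure M (A l) * real (k l))) \<longlonglongrightarrow> 0"
  then have "\<not> (\<lambda>l. G l - \<theta> * exp (- \<theta> * (m l * real (k l)))) \<longlonglongrightarrow> 0"
    by (simp add: G_def m_def mult.assoc)
  then obtain e where e: "e > 0"
    and "\<not> eventually (\<lambda>l. \<bar>G l - \<theta> * exp (- \<theta> * (m l * real (k l)))\<bar> < e) sequentially"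
    unfolding tendsto_iff dist_real_def by auto
  \<comment> \<open>A subsequence stays at distance at least \<open>e\<close>. By compactness of the
    interval from \<open>\<delta>\<close> to \<open>inverse \<delta>\<close>, a further subsequence
    has rescaled times converging to some \<open>t\<close>, and along it the distance turns out to
    vanish.\<close>
  then obtain r :: "nat \<Rightarrow> nat" where r: "strict_mono r"
    and far: "\<And>n. \<not> \<bar>G (r n) - \<theta> * exp (- \<theta> * (m (r n) * real (k (r n))))\<bar> < e"
    using not_eventually_sequentiallyD by blast
  define \<tau> where "\<tau> n = m (r n) * real (k (r n))" for n
  have "\<forall>n. \<tau> n \<in> {\<delta>..inverse \<delta>}"
    using time_seqs_delta_bounds[OF k] by (simp add: \<tau>_def m_def)
  with compact_imp_seq_compact[OF compact_Icc] obtain t s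
    where t: "t \<in> {\<delta>..inverse \<delta>}" and s: "strict_mono s" and lim_t: "(\<tau> \<circ> s) \<longlonglongrightarrow> t"
    by (rule seq_compactE)
  define q where "q = r \<circ> s"
  have q: "strict_mono q" unfolding q_def using r s by (rule strict_mono_o)
  have lim_t: "(\<lambda>n. m (q n) * real (k (q n))) \<longlonglongrightarrow> t" using lim_t by (simp add: q_def o_def \<tau>_def)
  have lim_m: "(\<lambda>n. m (q n)) \<longlonglongrightarrow> 0"
    using LIMSEQ_subseq_LIMSEQ[OF lim q] by (simp add: o_def m_def)
  have lim_F: "(\<lambda>n. F (q n) b - F (q n) a) \<longlonglongrightarrow> exp (- \<theta> * a) - exp (- \<theta> * b)"
    if "0 < a" "0 < b" for a b
    using tendsto_diff[OF F_lim F_lim, THEN LIMSEQ_subseq_LIMSEQ, OF that(2) that(1) q]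
    by (simp add: o_def)
  have t0: "0 < t" using t \<delta> by auto
  have cont: "isCont (\<lambda>a. \<theta> * exp (- \<theta> * a)) t" by (intro continuous_intros)
  have "(\<lambda>n. G (q n)) \<longlonglongrightarrow> \<theta> * exp (- \<theta> * t)"
  proof (rule order_tendstoI)
    fix u assume u: "\<theta> * exp (- \<theta> * t) < u"
    \<comment> \<open>An interval from \<open>a\<close> to \<open>b\<close> strictly left of
      \<open>t\<close> is eventually left of the rescaled time, so the average density over it
      bounds \<open>G\<close> from above. By continuity \<open>a\<close> can be chosen with limit
      density still below \<open>u\<close>.\<close>
    have "eventually (\<lambda>a. \<theta> * exp (- \<theta> * a) < u \<and> 0 < a) (at_left t)"
      using order_tendstoD(2)[OF cont[unfolded isCont_def] u]
        eventually_at_leftI[of 0 t "\<lambda>a. 0 < a"] t0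
      by (auto simp: at_eq_sup_left_right eventually_sup eventually_conj_iff)
    then obtain a where a: "\<theta> * exp (- \<theta> * a) < u" "0 < a" "a < t"
      using t0 unfolding eventually_at_left_field by (metis dense)
    obtain b where b: "a < b" "b < t" using a(3) dense by blast
    have "(\<lambda>n. (F (q n) b - F (q n) a) / (b - a - m (q n)))
        \<longlonglongrightarrow> (exp (- \<theta> * a) - exp (- \<theta> * b)) / (b - a - 0)"
      using a b by (intro tendsto_intros lim_F lim_m) auto
    moreover have "(exp (- \<theta> * a) - exp (- \<theta> * b)) / (b - a - 0) < u"
    proof -
      have "(exp (- \<theta> * a) - exp (- \<theta> * b)) / (b - a) \<le> \<theta> * exp (- \<theta> * a)"
        using exp_decay_diff_bounds(1)[of \<theta> a b] b by (simp add: field_simps)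
      then show ?thesis using a by simp
    qed
    ultimately have "eventually (\<lambda>n. (F (q n) b - F (q n) a) / (b - a - m (q n)) < u) sequentially"
      by (rule order_tendstoD)
    moreover have "eventually (\<lambda>n. b < m (q n) * real (k (q n))) sequentially"
      using lim_t b(2) by (rule order_tendstoD)
    moreover have "eventually (\<lambda>n. m (q n) < b - a) sequentially"
      using lim_m b by (intro order_tendstoD) auto
    ultimately show "eventually (\<lambda>n. G (q n) < u) sequentially"
    proof eventually_elim
      case (elim n)
      have "(b - a - m (q n)) * (m (q n) * G (q n)) \<le> m (q n) * (F (q n) b - F (q n) a)"
        using measure_scaled_hitting_time_diff(1)[OF A[of "q n"] m[of "q n"], of a b "k (q n)"] elim a b m[of "q n"]
        by (simp add: F_def G_def m_def)
      then have "m (q n) * ((b - a - m (q n)) * G (q n)) \<le> m (q n) * (F (q n) b - F (q n) a)"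
        by (simp only: mult.left_commute)
      then have "(b - a - m (q n)) * G (q n) \<le> F (q n) b - F (q n) a"
        using m[of "q n"] by simp
      then have "G (q n) \<le> (F (q n) b - F (q n) a) / (b - a - m (q n))"
        using elim by (simp add: pos_le_divide_eq mult.commute)
      then show ?case using elim by simp
    qed
  next
    fix u assume u: "u < \<theta> * exp (- \<theta> * t)"
    \<comment> \<open>Mirror image: the interval lies strictly right of \<open>t\<close>, and
      averages over it bound \<open>G\<close> from below.\<close>
    have "eventually (\<lambda>b. u < \<theta> * exp (- \<theta> * b)) (at_right t)"
      using order_tendstoD(1)[OF cont[unfolded isCont_def] u]
      by (auto simp: at_eq_sup_left_right eventually_sup)
    then obtain b where b: "u < \<theta> * exp (- \<theta> * b)" "t < b"
      unfolding eventually_at_right_field by (metis dense)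
    obtain a where a: "t < a" "a < b" using b(2) dense by blast
    have "(\<lambda>n. (F (q n) b - F (q n) a) / (b - a + m (q n)))
        \<longlonglongrightarrow> (exp (- \<theta> * a) - exp (- \<theta> * b)) / (b - a + 0)"
      using a b t0 by (intro tendsto_intros lim_F lim_m) auto
    moreover have "u < (exp (- \<theta> * a) - exp (- \<theta> * b)) / (b - a + 0)"
    proof -
      have "\<theta> * exp (- \<theta> * b) \<le> (exp (- \<theta> * a) - exp (- \<theta> * b)) / (b - a)"
        using exp_decay_diff_bounds(2)[of \<theta> b a] a by (simp add: field_simps)
      then show ?thesis using b by simp
    qed
    ultimately have "eventually (\<lambda>n. u < (F (q n) b - F (q n) a) / (b - a + m (q n))) sequentially"
      by (rule order_tendstoD)
    moreover have "eventually (\<lambda>n. m (q n) * real (k (q n)) < a) sequentially"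
      using lim_t a(1) by (rule order_tendstoD)
    ultimately show "eventually (\<lambda>n. u < G (q n)) sequentially"
    proof eventually_elim
      case (elim n)
      \<comment> \<open>Monotonicity starts at index 1; the positive lower bound
        \<open>\<delta>\<close> excludes \<open>k = 0\<close>.\<close>
      have "1 \<le> k (q n)"
        using time_seqs_delta_bounds(1)[OF k, of "q n"] \<delta> by (cases "k (q n)") auto
      then have "m (q n) * (F (q n) b - F (q n) a) \<le> (b - a + m (q n)) * (m (q n) * G (q n))"
        using measure_scaled_hitting_time_diff(2)[OF A[of "q n"] m[of "q n"], of a b "k (q n)"] elim a t0 m[of "q n"]
        by (simp add: F_def G_def m_def)
      then have "m (q n) * (F (q n) b - F (q n) a) \<le> m (q n) * ((b - a + m (q n)) * G (q n))"
        by (simp only: mult.left_commute)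
      then have "F (q n) b - F (q n) a \<le> (b - a + m (q n)) * G (q n)"
        using m[of "q n"] by simp
      then have "(F (q n) b - F (q n) a) / (b - a + m (q n)) \<le> G (q n)"
        using a m[of "q n"] by (simp add: pos_divide_le_eq add_pos_pos mult.commute)
      then show ?case using elim by simp
    qed
  qed
  from tendsto_diff[OF this isCont_tendsto_compose[OF cont lim_t]]
  have "(\<lambda>n. G (q n) - \<theta> * exp (- \<theta> * (m (q n) * real (k (q n))))) \<longlonglongrightarrow> 0" by simp
  from LIMSEQ_D[OF this e] obtain n0
    where "\<And>n. n \<ge> n0 \<Longrightarrow> \<bar>G (q n) - \<theta> * exp (- \<theta> * (m (q n) * real (k (q n))))\<bar> < e" by auto
  then show False using far[of "s n0"] by (simp add: q_def)
qed

subsection \<open>Splitting at the first return\<close>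

lemma space_entrance_distr: "A \<in> sets M \<Longrightarrow> space (entrance_distr M T A N) = A"
  by (simp add: entrance_distr_def space_restrict_space2)

lemma sets_entrance_distr: "sets (entrance_distr M T A N) = sets (restrict_space M A)"
  by (simp add: entrance_distr_def)

lemma sets_hit_at_trace:
  assumes T: "T \<in> measurable M M" and A: "A \<in> sets M"
    and N: "space N \<in> sets M" "sets N = sets (restrict_space M (space N))"
  shows "hit_at N T A k \<in> sets N"
proof -
  have "hit_at N T A k = space N \<inter> hit_at M T A k"
    using sets.sets_into_space[OF N(1)] by (auto simp: hit_at_def)
  then show ?thesis
    using sets_hit_at[OF T A] unfolding N(2) sets_restrict_space by blast
qed

text \<open>The domain of the first entrance map is a countable union of hitting events, hence
  measurable, and the map is measurable on it; the image measure is therefore computed by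
  preimages.\<close>

lemma measure_entrance_distr:
  assumes T: "T \<in> measurable M M" and A: "A \<in> sets M"
    and N: "space N \<in> sets M" "sets N = sets (restrict_space M (space N))"
    and B: "B \<in> sets M" "B \<subseteq> A"
  shows "measure (entrance_distr M T A N) B = measure N (space N \<inter> entrance_vimage M T A B)"
proof -
  define \<Omega> where "\<Omega> = {x \<in> space N. hitting_time T A x < \<infinity>}"
  have sub: "space N \<subseteq> space M" using N(1) by (rule sets.sets_into_space)
  have "\<Omega> = (\<Union>k. hit_at N T A k)"
    by (auto simp: \<Omega>_def hit_at_def elim: less_infinityE)
  then have \<Omega>: "\<Omega> \<in> sets N" using sets_hit_at_trace[OF T A N] by auto
  have vimage: "first_entrance T A -` S \<inter> \<Omega> = space N \<inter> entrance_vimage M T A S" for S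
    using sub by (auto simp: \<Omega>_def entrance_vimage_def)
  have "first_entrance T A \<in> measurable (restrict_space N \<Omega>) (restrict_space M A)"
  proof (rule measurableI)
    fix x assume "x \<in> space (restrict_space N \<Omega>)"
    then have "x \<in> space N" "hitting_time T A x < \<infinity>" by (auto simp: space_restrict_space \<Omega>_def)
    then show "first_entrance T A x \<in> space (restrict_space M A)"
      using first_entrance_in_space[OF T, of x A] sub
      by (auto simp: space_restrict_space elim!: less_infinityE dest: first_entrance_mem)
  next
    fix S assume "S \<in> sets (restrict_space M A)"
    then have "S \<in> sets M" using A by (simp add: sets_restrict_space_iff)
    then have "S \<inter> space M \<in> sets M" by auto
    then have "space N \<inter> entrance_vimage M T A S \<in> sets N"
      using sets_entrance_vimage[OF T A] unfolding N(2) sets_restrict_space by blast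
    then show "first_entrance T A -` S \<inter> space (restrict_space N \<Omega>) \<in> sets (restrict_space N \<Omega>)"
      using \<Omega> vimage[of S]
      by (simp add: sets_restrict_space_iff space_restrict_space2) (metis Int_lower2)
  qed
  then show ?thesis
    using A B \<Omega> vimage[of B]
    unfolding entrance_distr_def \<Omega>_def[symmetric]
    by (simp add: measure_distr sets_restrict_space_iff
        space_restrict_space2 measure_restrict_space sets.Int_space_eq2)
      (metis Int_lower2 measure_restrict_space sets.Int_space_eq2)
qed

text \<open>The multiplication rule for conditional probabilities: a hit at time \<open>k\<close>,
  then entrance in \<open>C\<close>, then the event \<open>E\<close> seen from the entrance point.
  The last two factors are taken on \<open>A\<close> because the entrance map is applied after
  conditioning on the hit.\<close>

lemma measure_first_visit_split:
  fixes k :: nat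
  assumes T: "T \<in> measurable M M" and A: "A \<in> sets M"
    and N: "prob_space N" "space N \<in> sets M" "sets N = sets (restrict_space M (space N))"
    and C: "C \<in> sets M" "C \<subseteq> A" and E: "E \<inter> space M \<in> sets M"
  defines "N' \<equiv> entrance_distr M T A (uniform_measure N (hit_at N T A k))"
  assumes pos: "0 < measure N (hit_at N T A k)" "0 < measure N' C"
  shows "measure N (space N \<inter> (hit_at M T A k \<inter> entrance_vimage M T A C \<inter> entrance_vimage M T A E))
    = measure N (hit_at N T A k) * measure N' C
      * measure (uniform_measure N' C) (space (uniform_measure N' C) \<inter> E)"
proof -
  interpret N: prob_space N by fact
  let ?h = "hit_at N T A k"
  have sub: "space N \<subseteq> space M" using N(2) by (rule sets.sets_into_space)
  have h: "?h \<in> sets N" using T A N(2,3) by (rule sets_hit_at_trace)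
  \<comment> \<open>Pushing the conditioned measure forward gives the conditional probability, given
    \<open>?h\<close>, of the entrance preimage.\<close>
  have "measure N' B = measure N (?h \<inter> entrance_vimage M T A B) / measure N ?h"
    if B: "B \<in> sets M" "B \<subseteq> A" for B
  proof -
    have "space N \<inter> entrance_vimage M T A B \<in> sets N"
      using sets_entrance_vimage[OF T A, of B] B unfolding N(3) sets_restrict_space by blast
    moreover have "?h \<inter> (space N \<inter> S) = ?h \<inter> S" for S by (auto simp: hit_at_def)
    ultimately show ?thesis
      using pos(1) B N(2,3) measure_entrance_distr[OF T A, of "uniform_measure N ?h" B]
      by (simp add: N'_def N.emeasure_eq_measure)
  qed
  then have N': "measure N (?h \<inter> entrance_vimage M T A B) = measure N ?h * measure N' B"
    if "B \<in> sets M" "B \<subseteq> A" for B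
    using that pos(1) by simp
  \<comment> \<open>\<open>E\<close> may be \<open>UNIV\<close>; measurability is known for its part
    in the space.\<close>
  have CE: "C \<inter> E = C \<inter> (E \<inter> space M)" using sets.sets_into_space[OF C(1)] by blast
  have CE_M: "C \<inter> E \<in> sets M" using C(1) E unfolding CE by (rule sets.Int)
  have "space N \<inter> (hit_at M T A k \<inter> entrance_vimage M T A C \<inter> entrance_vimage M T A E)
      = ?h \<inter> entrance_vimage M T A (C \<inter> E)"
    using sub by (auto simp: hit_at_def entrance_vimage_def)
  then have "measure N (space N \<inter> (hit_at M T A k \<inter> entrance_vimage M T A C \<inter> entrance_vimage M T A E))
      = measure N ?h * measure N' (C \<inter> E)"
    using N'[OF CE_M] C(2) by auto
  moreover have "measure (uniform_measure N' C) (space (uniform_measure N' C) \<inter> E)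
      = measure N' (C \<inter> E) / measure N' C"
  proof -
    have A_E: "A \<inter> E \<in> sets N'"
    proof -
      have "A \<inter> E = A \<inter> (E \<inter> space M)" using sets.sets_into_space[OF A] by blast
      then have "A \<inter> E \<in> sets M" using A E by auto
      then show ?thesis using A by (simp add: N'_def sets_entrance_distr sets_restrict_space_iff)
    qed
    have "emeasure N' C \<noteq> 0" "emeasure N' C \<noteq> \<infinity>"
      using pos(2) by (auto simp: measure_def)
    then have "measure (uniform_measure N' C) (A \<inter> E) = measure N' (C \<inter> (A \<inter> E)) / measure N' C"
      using A_E by (rule measure_uniform_measure)
    moreover have "C \<inter> (A \<inter> E) = C \<inter> E" using C(2) by blast
    moreover have "space (uniform_measure N' C) = A"
      using space_entrance_distr[OF A] by (simp add: N'_def)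
    ultimately show ?thesis by simp
  qed
  ultimately show ?thesis using pos(2) by simp
qed

text \<open>Every point with a finite hitting time enters \<open>A\<close>, so no mass is lost when
  the conditioned measure is pushed forward.\<close>

lemma measure_entrance_distr_whole:
  assumes T: "T \<in> measurable M M" and A: "A \<in> sets M"
    and N: "prob_space N" "space N \<in> sets M" "sets N = sets (restrict_space M (space N))"
    and pos: "0 < measure N (hit_at N T A k)"
  shows "measure (entrance_distr M T A (uniform_measure N (hit_at N T A k))) A = 1"
proof -
  interpret N: prob_space N by fact
  let ?h = "hit_at N T A k"
  have "space N \<inter> entrance_vimage M T A A \<in> sets N"
    using sets_entrance_vimage[OF T A, of A] A unfolding N(3) sets_restrict_space by blast
  moreover have "?h \<inter> (space N \<inter> entrance_vimage M T A A) = ?h"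
    using sets.sets_into_space[OF N(2)]
    by (auto simp: hit_at_def entrance_vimage_def first_entrance_mem)
  ultimately show ?thesis
    using pos A N(2,3) measure_entrance_distr[OF T A, of "uniform_measure N ?h" A]
    by (simp add: N.emeasure_eq_measure)
qed

lemma eventually_pos_of_ratio_tendsto_1:
  fixes a b :: "nat \<Rightarrow> real"
  assumes "(\<lambda>l. a l / b l) \<longlonglongrightarrow> 1" "\<And>l. 0 < b l"
  shows "eventually (\<lambda>l. 0 < a l) sequentially"
proof -
  have "eventually (\<lambda>l. 0 < a l / b l) sequentially"
    using assms(1) by (rule order_tendstoD) simp
  then show ?thesis
    by eventually_elim (use assms(2) in \<open>auto simp: zero_less_divide_iff dest: less_asym\<close>)
qed

section \<open>Adding one return, in terms of ratios\<close>

locale entrance_closed_family = measure_preserving_system M T for M :: "'a measure" and T +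
  fixes A :: "nat \<Rightarrow> 'a set" and V :: "nat \<Rightarrow> 'a measure set"
  assumes A: "\<And>l. A l \<in> sets M"
    and V_nonempty: "\<And>l. V l \<noteq> {}"
    and V_prob: "\<And>l \<nu>. \<nu> \<in> V l \<Longrightarrow> prob_space \<nu> \<and> sets \<nu> = sets (restrict_space M (A l))"
    and closed: "entrance_closed M T A V V"
begin

lemma V_space: "\<nu> \<in> V l \<Longrightarrow> space \<nu> = A l"
  using V_prob[of \<nu> l] A[of l] by (metis sets_eq_imp_space_eq space_restrict_space2)

text \<open>Three ratios multiply: the first hitting time, the target of the first visit, and the
  remaining returns. The measures \<open>\<nu> l\<close> may live on \<open>A l\<close> or on the
  whole space, so that the step serves both the induction within \<open>V\<close> and the first
  return from an initial measure. \<open>tail\<close> ranges over all sequences in \<open>V\<close>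
  because conditioning produces a new one.\<close>

lemma ratio_step:
  fixes \<nu> :: "nat \<Rightarrow> 'a measure" and k :: "nat \<Rightarrow> nat \<Rightarrow> nat"
  assumes \<nu>: "\<And>l. prob_space (\<nu> l)" "\<And>l. space (\<nu> l) \<in> sets M"
      "\<And>l. sets (\<nu> l) = sets (restrict_space M (space (\<nu> l)))"
    and hit: "(\<lambda>l. measure (\<nu> l) (hit_at (\<nu> l) T (A l) (k 1 l)) / h l) \<longlonglongrightarrow> 1" "\<And>l. 0 < h l"
    and entrance: "\<And>l. 0 < measure (\<nu> l) (hit_at (\<nu> l) T (A l) (k 1 l)) \<Longrightarrow>
      entrance_distr M T (A l) (uniform_measure (\<nu> l) (hit_at (\<nu> l) T (A l) (k 1 l))) \<in> V l"
    and C: "admissible_targets M T A V (Suc d) C c"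
    and C1: "(\<lambda>l. measure (entrance_distr M T (A l)
                  (uniform_measure (\<nu> l) (hit_at (\<nu> l) T (A l) (k 1 l)))) (C 1 l) / c 1 l) \<longlonglongrightarrow> 1"
    and tail: "\<And>\<nu>. \<nu> \<in> Pi UNIV V \<Longrightarrow>
      (\<lambda>l. measure (\<nu> l) (space (\<nu> l) \<inter>
             target_hits_event M T (A l) d (\<lambda>j. k (Suc j) l) (\<lambda>j. C (Suc j) l)) / r l) \<longlonglongrightarrow> 1"
  shows "(\<lambda>l. measure (\<nu> l) (space (\<nu> l) \<inter>
             target_hits_event M T (A l) (Suc d) (\<lambda>j. k j l) (\<lambda>j. C j l)) / (h l * c 1 l * r l)) \<longlonglongrightarrow> 1"
proof -
  define p where "p l = measure (\<nu> l) (hit_at (\<nu> l) T (A l) (k 1 l))" for l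
  define \<nu>' where "\<nu>' l = entrance_distr M T (A l)
    (uniform_measure (\<nu> l) (hit_at (\<nu> l) T (A l) (k 1 l)))" for l
  define c' where "c' l = measure (\<nu>' l) (C 1 l)" for l
  \<comment> \<open>Conditioning needs both probabilities positive, which holds for large
    \<open>l\<close>. At the other indices an arbitrary member of \<open>V l\<close> keeps the
    sequence in the product, without effect on the limit.\<close>
  define \<nu>'' where "\<nu>'' l = (if 0 < p l \<and> 0 < c' l then uniform_measure (\<nu>' l) (C 1 l)
    else SOME \<nu>. \<nu> \<in> V l)" for l
  define E where "E l = target_hits_event M T (A l) d (\<lambda>j. k (Suc j) l) (\<lambda>j. C (Suc j) l)" for l
  have C_sets: "C j l \<in> sets M" "C j l \<subseteq> A l" if "j \<in> {1..Suc d}" for j l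
  proof -
    have "C j l \<in> sets (restrict_space M (A l))"
      using C that unfolding admissible_targets_def by blast
    then show "C j l \<in> sets M" "C j l \<subseteq> A l"
      using A[of l] by (simp_all add: sets_restrict_space_iff)
  qed
  have c_pos: "0 < c 1 l" for l using C by (auto simp: admissible_targets_def)
  have "\<nu>'' l \<in> V l" for l
  proof (cases "0 < p l \<and> 0 < c' l")
    case True
    then have "\<nu>' l \<in> V l" using entrance by (simp add: p_def \<nu>'_def)
    then show ?thesis using C True by (auto simp: \<nu>''_def admissible_targets_def c'_def)
  next
    case False
    have "(SOME \<nu>. \<nu> \<in> V l) \<in> V l" using V_nonempty[of l] by (simp add: some_in_eq)
    then show ?thesis unfolding \<nu>''_def if_not_P[OF False] .
  qed
  then have "(\<lambda>l. measure (\<nu>'' l) (space (\<nu>'' l) \<inter> E l) / r l) \<longlonglongrightarrow> 1"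
    unfolding E_def by (intro tail) auto
  then have "(\<lambda>l. p l / h l * (c' l / c 1 l) * (measure (\<nu>'' l) (space (\<nu>'' l) \<inter> E l) / r l)) \<longlonglongrightarrow> 1 * 1 * 1"
    using hit(1) C1 unfolding p_def c'_def \<nu>'_def by (intro tendsto_mult)
  then have ratios: "(\<lambda>l. p l / h l * (c' l / c 1 l) * (measure (\<nu>'' l) (space (\<nu>'' l) \<inter> E l) / r l)) \<longlonglongrightarrow> 1"
    by simp
  have p_pos: "eventually (\<lambda>l. 0 < p l) sequentially"
    using hit unfolding p_def by (rule eventually_pos_of_ratio_tendsto_1)
  have "eventually (\<lambda>l. 0 < c' l) sequentially"
    using C1 c_pos unfolding c'_def \<nu>'_def by (rule eventually_pos_of_ratio_tendsto_1)
  \<comment> \<open>Once both conditioning events have positive mass, the multiplication rule makes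
    the product of the ratios equal to the ratio for the whole event.\<close>
  then have "eventually (\<lambda>l. p l / h l * (c' l / c 1 l) * (measure (\<nu>'' l) (space (\<nu>'' l) \<inter> E l) / r l)
    = measure (\<nu> l) (space (\<nu> l) \<inter>
        target_hits_event M T (A l) (Suc d) (\<lambda>j. k j l) (\<lambda>j. C j l)) / (h l * c 1 l * r l)) sequentially"
    using p_pos
  proof eventually_elim
    case (elim l)
    have E_sets: "E l \<inter> space M \<in> sets M"
      unfolding E_def using measurable_T A C_sets by (intro sets_target_hits_event) auto
    have "C 1 l \<in> sets M" "C 1 l \<subseteq> A l" using C_sets[of 1 l] by simp_all
    then have "measure (\<nu> l) (space (\<nu> l) \<inter>
        target_hits_event M T (A l) (Suc d) (\<lambda>j. k j l) (\<lambda>j. C j l))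
      = p l * c' l * measure (\<nu>'' l) (space (\<nu>'' l) \<inter> E l)"
      unfolding target_hits_event_Suc
      using measure_first_visit_split[OF measurable_T A[of l] \<nu>(1)[of l] \<nu>(2,3) _ _ E_sets, of "C 1 l" "k 1 l"] elim
      by (simp add: p_def c'_def \<nu>'_def \<nu>''_def E_def o_def)
    then show ?case by (simp add: mult_ac)
  qed
  with ratios show ?thesis by (rule Lim_transform_eventually)
qed

end

section \<open>Uniform relations along sequences, relative errors, and short returns\<close>

lemma unif_asympD_sequences:
  assumes "unif_asymp P a b" "\<And>l. x l \<in> P"
  shows "(\<lambda>l. a (x l) l / b (x l) l) \<longlonglongrightarrow> 1"
proof (rule LIMSEQ_I)
  fix r :: real assume "0 < r"
  then obtain l0 where "\<forall>l\<ge>l0. \<forall>p\<in>P. \<bar>a p l / b p l - 1\<bar> \<le> r / 2"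
    using assms(1) unfolding unif_asymp_def by (meson half_gt_zero)
  then have "\<forall>l\<ge>l0. \<bar>a (x l) l / b (x l) l - 1\<bar> \<le> r / 2"
    using assms(2) by blast
  then have "\<forall>l\<ge>l0. norm (a (x l) l / b (x l) l - 1) < r"
    using \<open>0 < r\<close> by (auto intro: le_less_trans)
  then show "\<exists>l0. \<forall>l\<ge>l0. norm (a (x l) l / b (x l) l - 1) < r" by blast
qed

lemma unif_smalloD_sequences:
  assumes "unif_smallo P a b" "\<And>l. x l \<in> P" "\<And>l. 0 < b (x l) l"
  shows "(\<lambda>l. a (x l) l / b (x l) l) \<longlonglongrightarrow> 0"
proof (rule LIMSEQ_I)
  fix r :: real assume "0 < r"
  then obtain l0 where l0: "\<forall>l\<ge>l0. \<forall>p\<in>P. \<bar>a p l\<bar> \<le> r / 2 * b p l"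
    using assms(1) unfolding unif_smallo_def by (meson half_gt_zero)
  have "norm (a (x l) l / b (x l) l - 0) < r" if "l \<ge> l0" for l
  proof -
    have "\<bar>a (x l) l\<bar> / b (x l) l \<le> r / 2"
      using l0 that assms(2,3) by (simp add: pos_divide_le_eq)
    moreover have "norm (a (x l) l / b (x l) l - 0) = \<bar>a (x l) l\<bar> / b (x l) l"
      using assms(3)[of l] by (simp add: abs_divide)
    ultimately show ?thesis using \<open>0 < r\<close> by linarith
  qed
  then show "\<exists>l0. \<forall>l\<ge>l0. norm (a (x l) l / b (x l) l - 0) < r" by blast
qed

text \<open>The bound on \<open>m l * k l\<close> keeps the exponential factor above
  \<open>exp (- \<theta> * K)\<close>, so an absolute error that is small compared with
  \<open>m l\<close> is also a small relative error.\<close>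

lemma ratio_tendsto_1_of_local_limit:
  fixes X m :: "nat \<Rightarrow> real"
  assumes m: "\<And>l. 0 < m l" and q: "0 < q" and \<theta>: "0 < \<theta>"
    and bound: "\<And>l. m l * real (k l) \<le> K"
    and lim: "(\<lambda>l. X l / m l - q * exp (- \<theta> * m l * real (k l))) \<longlonglongrightarrow> 0"
  shows "(\<lambda>l. X l / (q * m l * exp (- \<theta> * m l * real (k l)))) \<longlonglongrightarrow> 1"
proof -
  define e where "e l = exp (- \<theta> * m l * real (k l))" for l
  have e: "exp (- \<theta> * K) \<le> e l" "0 < e l" for l
    using mult_left_mono[OF bound, of \<theta> l] \<theta> by (simp_all add: e_def mult.assoc)
  have "(\<lambda>l. (X l / m l - q * e l) / (q * e l)) \<longlonglongrightarrow> 0"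
  proof (rule tendsto_0_le[OF lim[folded e_def], of _ "1 / (q * exp (- \<theta> * K))"])
    show "eventually (\<lambda>l. norm ((X l / m l - q * e l) / (q * e l))
      \<le> norm (X l / m l - q * e l) * (1 / (q * exp (- \<theta> * K)))) sequentially"
    proof (rule always_eventually, rule allI)
      fix l
      have "\<bar>X l / m l - q * e l\<bar> / (q * e l) \<le> \<bar>X l / m l - q * e l\<bar> / (q * exp (- \<theta> * K))"
        using e(1)[of l] q by (intro divide_left_mono) (auto intro!: mult_pos_pos e(2))
      then show "norm ((X l / m l - q * e l) / (q * e l))
        \<le> norm (X l / m l - q * e l) * (1 / (q * exp (- \<theta> * K)))"
        using e(2)[of l] q by (simp add: abs_mult)
    qed
  qed
  then have "(\<lambda>l. (X l / m l - q * e l) / (q * e l) + 1) \<longlonglongrightarrow> 0 + 1"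
    by (intro tendsto_add tendsto_const)
  moreover have "(X l / m l - q * e l) / (q * e l) + 1 = X l / (q * m l * e l)" for l
    using m[of l] q e(2)[of l] by (simp add: field_simps)
  ultimately show ?thesis by (simp add: e_def)
qed

text \<open>Almost everywhere on \<open>B\<close> the hitting time is at most its essential
  supremum, which is below \<open>k\<close>. If \<open>B\<close> is a null set, the essential
  supremum carries no information, but then the intersection is null as well.\<close>

lemma measure_hit_at_short_part_eq_0:
  assumes N: "prob_space N" and T: "T \<in> measurable M M" and A: "A \<in> sets M"
    and space: "space N \<in> sets M" "sets N = sets (restrict_space M (space N))"
    and B: "B \<in> sets N"
    and short: "esssup (cond_or_zero N B)
               (\<lambda>x. indicator B x * ennreal_of_enat (hitting_time T A x)) < ennreal (real k)"
  shows "measure N (B \<inter> hit_at N T A k) = 0"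
proof (cases "0 < measure N B")
  case True
  interpret prob_space N by fact
  let ?f = "\<lambda>x. indicator B x * ennreal_of_enat (hitting_time T A x)"
  have "AE x in uniform_measure N B. ?f x \<le> esssup (cond_or_zero N B) ?f"
    using esssup_AE[of ?f "cond_or_zero N B"] True by (simp only: cond_or_zero_def if_True)
  then have "AE x in N. x \<in> B \<longrightarrow> ?f x \<le> esssup (cond_or_zero N B) ?f"
    using True by (subst (asm) AE_uniform_measure) (auto simp: emeasure_eq_measure)
  then have "AE x in N. x \<notin> B \<inter> hit_at N T A k"
  proof eventually_elim
    case (elim x)
    show ?case
    proof
      assume "x \<in> B \<inter> hit_at N T A k"
      then have "ennreal (real k) \<le> esssup (cond_or_zero N B) ?f"
        using elim by (simp add: hit_at_def ennreal_of_nat_eq_real_of_nat)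
      with short show False by simp
    qed
  qed
  then show ?thesis
    using B sets_hit_at_trace[OF T A space, of k] by (subst prob_eq_0) auto
next
  case False
  interpret prob_space N by fact
  from False have "measure N B = 0" by (simp add: zero_less_measure_iff)
  then show ?thesis
    using finite_measure_mono[of "B \<inter> hit_at N T A k" B] B measure_nonneg[of N] by (simp add: antisym)
qed

section \<open>Products over several returns\<close>

context entrance_closed_family
begin

text \<open>Each step of the induction on \<open>d\<close> passes to conditioned measures and to
  shifted times and targets, so the claim ranges over all of them. The rate \<open>h\<close> stays
  abstract until the product is evaluated.\<close>

lemma target_hits_limit:
  fixes k :: "nat \<Rightarrow> nat \<Rightarrow> nat"
  assumes hit: "\<And>\<nu> k. \<nu> \<in> Pi UNIV V \<Longrightarrow> k \<in> time_seqs_delta M A \<delta> \<Longrightarrow>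
      (\<lambda>l. measure (\<nu> l) (hit_at (\<nu> l) T (A l) (k l)) / h (k l) l) \<longlonglongrightarrow> 1"
    and h: "\<And>k l. 0 < h k l" and \<delta>: "\<delta> \<in> {0<..1}"
    and C: "admissible_targets M T A V d C c"
    and k: "k \<in> {1..d} \<rightarrow> time_seqs_delta M A \<delta>"
    and \<nu>: "\<nu> \<in> Pi UNIV V"
  shows "(\<lambda>l. measure (\<nu> l) (space (\<nu> l) \<inter>
             target_hits_event M T (A l) d (\<lambda>j. k j l) (\<lambda>j. C j l))
           / (\<Prod>j=1..d. h (k j l) l * c j l)) \<longlonglongrightarrow> 1"
  using C k \<nu>
proof (induction d arbitrary: k C c \<nu>)
  case 0
  \<comment> \<open>With no returns the event is \<open>UNIV\<close>; its part in the space has mass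
    1, matching the empty product.\<close>
  have "measure (\<nu> l) (space (\<nu> l)) = 1" for l
    using V_prob[of "\<nu> l" l] 0 by (intro prob_space.prob_space) blast
  then show ?case by (simp add: target_hits_event_def)
next
  case (Suc d)
  have K: "k 1 \<in> time_seqs_delta M A \<delta>" using Suc.prems by auto
  then have K': "k 1 \<in> time_seqs M A" using \<delta> by (auto simp: time_seqs_def)
  have \<nu>: "\<nu> l \<in> V l" for l using Suc.prems by auto
  \<comment> \<open>The parameters of \<open>entrance_asymp\<close> are whole sequences of measures;
    the same sequence \<open>\<nu>\<close> is chosen at every index.\<close>
  have "(\<lambda>l. measure (entrance_distr M T (A l)
      (uniform_measure (\<nu> l) (hit_at (\<nu> l) T (A l) (k 1 l)))) (C 1 l) / c 1 l) \<longlonglongrightarrow> 1"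
    using Suc.prems(1,3) K' unfolding admissible_targets_def entrance_asymp_def
    by (auto dest!: bspec[of _ _ "1::nat"] bspec[OF _ K'] unif_asympD_sequences[where x = "\<lambda>_. \<nu>"])
  moreover have "admissible_targets M T A V d (\<lambda>j. C (Suc j)) (\<lambda>j. c (Suc j))"
    using Suc.prems(1) by (auto simp: admissible_targets_def)
  moreover have "(\<lambda>j. k (Suc j)) \<in> {1..d} \<rightarrow> time_seqs_delta M A \<delta>"
    using Suc.prems(2) by auto
  moreover have "\<nu>' \<in> V l \<Longrightarrow> prob_space \<nu>' \<and> space \<nu>' \<in> sets M \<and>
      sets \<nu>' = sets (restrict_space M (space \<nu>'))" for \<nu>' l
    using V_prob[of \<nu>' l] V_space[of \<nu>' l] A[of l] by simp
  ultimately have "(\<lambda>l. measure (\<nu> l) (space (\<nu> l) \<inter>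
             target_hits_event M T (A l) (Suc d) (\<lambda>j. k j l) (\<lambda>j. C j l))
      / (h (k 1 l) l * c 1 l * (\<Prod>j=1..d. h (k (Suc j) l) l * c (Suc j) l))) \<longlonglongrightarrow> 1"
    using Suc.prems(1) \<nu> closed K' hit[OF Suc.prems(3) K]
    by (intro ratio_step Suc.IH) (auto simp: h entrance_closed_def)
  moreover have "(\<Prod>j=1..Suc d. f j) = f 1 * (\<Prod>j=1..d. f (Suc j))" for f :: "nat \<Rightarrow> real"
    by (simp add: prod.atLeast_Suc_atMost prod.atLeast_Suc_atMost_Suc_shift del: prod.cl_ivl_Suc)
  ultimately show ?case by (simp only:)
qed

text \<open>Only the first return starts from a measure in \<open>W\<close>, with its own rate
  \<open>h'\<close>. After it the entrance distributions lie in \<open>V\<close>, where the limit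
  for the remaining \<open>d - 1\<close> returns applies.\<close>

lemma target_hits_limit_initial:
  fixes k :: "nat \<Rightarrow> nat \<Rightarrow> nat"
  assumes hit: "\<And>\<nu> k. \<nu> \<in> Pi UNIV V \<Longrightarrow> k \<in> time_seqs_delta M A \<delta> \<Longrightarrow>
      (\<lambda>l. measure (\<nu> l) (hit_at (\<nu> l) T (A l) (k l)) / h (k l) l) \<longlonglongrightarrow> 1"
    and h: "\<And>k l. 0 < h k l" "\<And>k l. 0 < h' k l" and \<delta>: "\<delta> \<in> {0<..1}"
    and C: "admissible_targets M T A V d C c" and d: "1 \<le> d"
    and k: "k \<in> {1..d} \<rightarrow> time_seqs_delta M A \<delta>"
    and \<nu>: "\<And>l. \<nu> l \<in> W"
    and W: "\<forall>\<nu>\<in>W. prob_space \<nu> \<and> sets \<nu> = sets M"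
    and W_hit: "(\<lambda>l. measure (\<nu> l) (hit_at (\<nu> l) T (A l) (k 1 l)) / h' (k 1 l) l) \<longlonglongrightarrow> 1"
    and W_closed: "entrance_closed M T A (\<lambda>l. W) V"
    and W_C: "entrance_asymp M T A ((\<lambda>\<nu> l. \<nu>) ` W) (C 1) (c 1)"
  shows "(\<lambda>l. measure (\<nu> l) (target_hits_event M T (A l) d (\<lambda>j. k j l) (\<lambda>j. C j l))
           / (h' (k 1 l) l * c 1 l * (\<Prod>j=2..d. h (k j l) l * c j l))) \<longlonglongrightarrow> 1"
proof -
  obtain d' where d': "d = Suc d'" using d by (cases d) auto
  have K: "k 1 \<in> time_seqs_delta M A \<delta>" using k d by auto
  then have K': "k 1 \<in> time_seqs M A" using \<delta> by (auto simp: time_seqs_def)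
  have space: "space \<nu>' = space M" if "\<nu>' \<in> W" for \<nu>'
    using W that by (intro sets_eq_imp_space_eq) blast
  \<comment> \<open>Here the parameters are constant sequences; at index \<open>l\<close> the one
    with value \<open>\<nu> l\<close> is chosen.\<close>
  have "(\<lambda>l. measure (entrance_distr M T (A l)
      (uniform_measure (\<nu> l) (hit_at (\<nu> l) T (A l) (k 1 l)))) (C 1 l) / c 1 l) \<longlonglongrightarrow> 1"
    using W_C[unfolded entrance_asymp_def, rule_format, OF K',
        THEN unif_asympD_sequences, of "\<lambda>l _. \<nu> l"] \<nu> by auto
  moreover have "admissible_targets M T A V d' (\<lambda>j. C (Suc j)) (\<lambda>j. c (Suc j))"
    using C by (auto simp: admissible_targets_def d')
  moreover have "(\<lambda>j. k (Suc j)) \<in> {1..d'} \<rightarrow> time_seqs_delta M A \<delta>"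
    using k by (auto simp: d')
  moreover have "sets (restrict_space M (space M)) = sets M"
    by (rule sets_restrict_space_space)
  ultimately have "(\<lambda>l. measure (\<nu> l) (space (\<nu> l) \<inter>
             target_hits_event M T (A l) (Suc d') (\<lambda>j. k j l) (\<lambda>j. C j l))
      / (h' (k 1 l) l * c 1 l * (\<Prod>j=1..d'. h (k (Suc j) l) l * c (Suc j) l))) \<longlonglongrightarrow> 1"
    using C \<nu> W W_closed K' W_hit \<delta>
    by (intro ratio_step target_hits_limit hit) (auto simp: h entrance_closed_def d' space)
  moreover have "space (\<nu> l) \<inter> target_hits_event M T (A l) (Suc d') n D
      = target_hits_event M T (A l) (Suc d') n D" for l n D
    unfolding target_hits_event_Suc using space[OF \<nu>] by (auto simp: hit_at_def)
  moreover have "(\<Prod>j=2..Suc d'. f j) = (\<Prod>j=1..d'. f (Suc j))" for f :: "nat \<Rightarrow> real"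
    by (simp add: prod.atLeast_Suc_atMost_Suc_shift numeral_2_eq_2 del: prod.cl_ivl_Suc)
  ultimately show ?thesis by (simp only: d')
qed

text \<open>The entrance distribution gives \<open>A l\<close> mass exactly 1 as soon as the
  conditioning event has positive mass. \<open>hit_pos\<close> uses the diagonal
  \<open>x l l\<close> because the parameter may change with \<open>l\<close> and only its entry at
  \<open>l\<close> matters.\<close>

lemma entrance_asymp_whole:
  assumes P: "\<And>\<nu> l. \<nu> \<in> P \<Longrightarrow> prob_space (\<nu> l) \<and> space (\<nu> l) \<in> sets M \<and>
      sets (\<nu> l) = sets (restrict_space M (space (\<nu> l)))"
    and hit_pos: "\<And>k x. k \<in> time_seqs M A \<Longrightarrow> (\<And>l. x l \<in> P) \<Longrightarrow>
      eventually (\<lambda>l. 0 < measure (x l l) (hit_at (x l l) T (A l) (k l))) sequentially"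
  shows "entrance_asymp M T A P A (\<lambda>l. 1)"
  unfolding entrance_asymp_def
proof (intro ballI unif_asympI_sequences)
  fix k and x :: "nat \<Rightarrow> nat \<Rightarrow> 'a measure" assume "k \<in> time_seqs M A" and x: "\<And>l. x l \<in> P"
  then have "eventually (\<lambda>l. 0 < measure (x l l) (hit_at (x l l) T (A l) (k l))) sequentially"
    by (intro hit_pos)
  then have "eventually (\<lambda>l. measure (entrance_distr M T (A l)
      (uniform_measure (x l l) (hit_at (x l l) T (A l) (k l)))) (A l) / 1 = 1) sequentially"
    by eventually_elim (use P[OF x] in \<open>simp add: measure_entrance_distr_whole[OF measurable_T A]\<close>)
  then show "(\<lambda>l. measure (entrance_distr M T (A l)
      (uniform_measure (x l l) (hit_at (x l l) T (A l) (k l)))) (A l) / 1) \<longlonglongrightarrow> 1"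
    by (rule tendsto_eventually)
qed

text \<open>A probability measure living on \<open>A l\<close> is unchanged by conditioning on
  \<open>A l\<close>. With these targets the statements with targets yield those without.\<close>

lemma admissible_targets_whole:
  assumes hit_pos: "\<And>k \<nu>. k \<in> time_seqs M A \<Longrightarrow> \<nu> \<in> Pi UNIV V \<Longrightarrow>
     eventually (\<lambda>l. 0 < measure (\<nu> l) (hit_at (\<nu> l) T (A l) (k l))) sequentially"
  shows "admissible_targets M T A V d (\<lambda>j. A) (\<lambda>j l. 1)"
proof -
  have "uniform_measure \<nu> (A l) = \<nu>" if "\<nu> \<in> V l" for \<nu> l
  proof (rule measure_eqI)
    interpret \<nu>: prob_space \<nu> using V_prob[OF that] by blast
    fix B assume "B \<in> sets (uniform_measure \<nu> (A l))"
    then show "emeasure (uniform_measure \<nu> (A l)) B = emeasure \<nu> B"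
      by (simp add: V_space[OF that, symmetric] \<nu>.emeasure_space_1 sets.Int_space_eq1 divide_ennreal_def)
  qed simp
  moreover have "entrance_asymp M T A (Pi UNIV V) A (\<lambda>l. 1)"
  proof (rule entrance_asymp_whole)
    fix \<nu> l assume "\<nu> \<in> Pi UNIV V"
    then have "\<nu> l \<in> V l" by auto
    then show "prob_space (\<nu> l) \<and> space (\<nu> l) \<in> sets M \<and>
      sets (\<nu> l) = sets (restrict_space M (space (\<nu> l)))"
      using V_prob[of "\<nu> l" l] V_space[of "\<nu> l" l] A[of l] by simp
  next
    fix k x assume "k \<in> time_seqs M A" "\<And>l::nat. x l \<in> Pi UNIV V"
    then show "eventually (\<lambda>l. 0 < measure (x l l) (hit_at (x l l) T (A l) (k l))) sequentially"
      by (intro hit_pos[of k "\<lambda>l. x l l"]) (auto simp: Pi_iff)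
  qed
  moreover have "A l \<in> sets (restrict_space M (A l))" for l
    using A[of l] by (simp add: sets_restrict_space_iff)
  ultimately show ?thesis by (simp add: admissible_targets_def)
qed

end


section \<open>Products of rates and the local limit for return times\<close>

lemma prod_hit_rates:
  fixes c :: "nat \<Rightarrow> real" and k :: "nat \<Rightarrow> nat"
  shows "(\<Prod>j=1..d. \<theta>^2 * m * exp (- \<theta> * m * real (k j)) * c j)
    = \<theta> ^ (2 * d) * m ^ d * (\<Prod>j=1..d. c j) * exp (- \<theta> * m * (\<Sum>j=1..d. real (k j)))"
  unfolding power_mult
  by (simp add: prod.distrib exp_sum[symmetric] sum_distrib_left sum_negf mult_ac)

text \<open>The first factor carries \<open>\<theta>\<close> where the others carry
  \<open>\<theta>^2\<close>. Multiplying by \<open>\<theta>\<close> gives the product with equal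
  factors, and \<open>\<theta>\<close> is then cancelled.\<close>

lemma prod_hit_rates_initial:
  fixes c :: "nat \<Rightarrow> real" and k :: "nat \<Rightarrow> nat"
  assumes "0 < \<theta>" "1 \<le> d"
  shows "\<theta> * m * exp (- \<theta> * m * real (k 1)) * c 1
      * (\<Prod>j=2..d. \<theta>^2 * m * exp (- \<theta> * m * real (k j)) * c j)
    = \<theta> ^ (2 * d - 1) * m ^ d * (\<Prod>j=1..d. c j) * exp (- \<theta> * m * (\<Sum>j=1..d. real (k j)))"
    (is "?l = ?r")
proof -
  have first: "(\<Prod>j=1..d. f j) = f 1 * (\<Prod>j=2..d. f j)" for f :: "nat \<Rightarrow> real"
    using assms(2) by (simp add: prod.atLeast_Suc_atMost numeral_2_eq_2)
  have "\<theta> * ?l = (\<Prod>j=1..d. \<theta>^2 * m * exp (- \<theta> * m * real (k j)) * c j)"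
    unfolding first by (simp add: power2_eq_square mult_ac)
  also have "\<dots> = \<theta> * ?r"
  proof -
    have "\<theta> ^ (2 * d) = \<theta> * \<theta> ^ (2 * d - 1)"
      using assms(2) by (simp add: power_eq_if)
    then show ?thesis unfolding prod_hit_rates by (simp only: mult.assoc)
  qed
  finally show ?thesis using assms(1) by simp
qed

text \<open>For large \<open>l\<close>, returns from \<open>Ab l\<close> almost surely happen before
  time \<open>\<delta> / m l\<close>, hence before \<open>k l\<close>, so only \<open>Ao l\<close>
  contributes. One factor \<open>\<theta>\<close> is the limit of its mass, the other comes from the
  density \<open>p l / m l\<close>.\<close>

lemma return_time_local_limit:
  fixes \<nu> :: "nat \<Rightarrow> 'a measure" and A Ab Ao :: "nat \<Rightarrow> 'a set" and m p :: "nat \<Rightarrow> real"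
  assumes T: "T \<in> measurable M M"
    and A: "\<And>l. A l \<in> sets M" and Ab: "\<And>l. Ab l \<in> sets M" and Ao: "\<And>l. Ao l \<in> sets M"
    and m: "\<And>l. 0 < m l"
    and split: "\<And>l. A l = Ab l \<union> Ao l" "\<And>l. Ab l \<inter> Ao l = {}"
    and \<nu>: "\<And>l. prob_space (\<nu> l)" "\<And>l. sets (\<nu> l) = sets (restrict_space M (A l))"
    and \<theta>: "0 < \<theta>" and \<theta>_lim: "(\<lambda>l. measure (\<nu> l) (Ao l)) \<longlonglongrightarrow> \<theta>"
    and short: "(\<lambda>l. ennreal (m l) * esssup (cond_or_zero (\<nu> l) (Ab l))
               (\<lambda>x. indicator (Ab l) x * ennreal_of_enat (hitting_time T (A l) x))) \<longlonglongrightarrow> 0"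
    and long: "(\<lambda>l. (measure (cond_or_zero (\<nu> l) (Ao l)) (hit_at (\<nu> l) T (A l) (k l)) - p l) / m l) \<longlonglongrightarrow> 0"
    and p: "(\<lambda>l. p l / m l - \<theta> * exp (- \<theta> * m l * real (k l))) \<longlonglongrightarrow> 0"
    and \<delta>: "0 < \<delta>" "\<And>l. \<delta> \<le> m l * real (k l)"
  shows "(\<lambda>l. measure (\<nu> l) (hit_at (\<nu> l) T (A l) (k l)) / m l
            - \<theta>^2 * exp (- \<theta> * m l * real (k l))) \<longlonglongrightarrow> 0"
proof -
  define S where "S l = esssup (cond_or_zero (\<nu> l) (Ab l))
    (\<lambda>x. indicator (Ab l) x * ennreal_of_enat (hitting_time T (A l) x))" for l
  define e where "e l = exp (- \<theta> * m l * real (k l))" for l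
  define h where "h l = hit_at (\<nu> l) T (A l) (k l)" for l
  define Q where "Q l = measure (cond_or_zero (\<nu> l) (Ao l)) (h l)" for l
  have space: "space (\<nu> l) = A l" for l
    using \<nu>(2)[of l] A[of l] by (metis sets_eq_imp_space_eq space_restrict_space2)
  have trace: "space (\<nu> l) \<in> sets M" "sets (\<nu> l) = sets (restrict_space M (space (\<nu> l)))" for l
    using A \<nu>(2) by (simp_all add: space)
  have B_sets: "Ab l \<in> sets (\<nu> l)" "Ao l \<in> sets (\<nu> l)" for l
    using A[of l] Ab[of l] Ao[of l] split(1)[of l] by (auto simp: \<nu>(2) sets_restrict_space_iff)
  have h_sets: "h l \<in> sets (\<nu> l)" for l
    unfolding h_def using T A trace by (rule sets_hit_at_trace)
  have "eventually (\<lambda>l. ennreal (m l) * S l < ennreal \<delta>) sequentially"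
    using short \<delta>(1) unfolding S_def by (intro order_tendstoD) auto
  moreover have "eventually (\<lambda>l. 0 < measure (\<nu> l) (Ao l)) sequentially"
    using \<theta>_lim \<theta> by (rule order_tendstoD)
  \<comment> \<open>Since the probability of \<open>h l\<close> is the mass of \<open>Ao l\<close>
    times \<open>Q l\<close>, the error splits into three: \<open>Q l\<close> against
    \<open>p l\<close>, \<open>p l / m l\<close> against its limit density, and the mass of
    \<open>Ao l\<close> against \<open>\<theta>\<close>.\<close>
  ultimately have eq: "eventually (\<lambda>l.
      measure (\<nu> l) (Ao l) * ((Q l - p l) / m l + (p l / m l - \<theta> * e l))
        + (measure (\<nu> l) (Ao l) - \<theta>) * (\<theta> * e l)
      = measure (\<nu> l) (h l) / m l - \<theta>^2 * e l) sequentially"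
  proof eventually_elim
    case (elim l)
    interpret \<nu>: prob_space "\<nu> l" by (rule \<nu>)
    have "S l < ennreal (real (k l))"
    proof (rule ccontr)
      assume "\<not> S l < ennreal (real (k l))"
      then have "ennreal (m l) * ennreal (real (k l)) \<le> ennreal (m l) * S l"
        by (intro mult_left_mono) auto
      moreover have "ennreal \<delta> \<le> ennreal (m l) * ennreal (real (k l))"
        using \<delta>(2)[of l] m[of l] by (simp add: ennreal_mult[symmetric] ennreal_leI less_imp_le)
      ultimately show False using elim(1) by (simp add: not_less[symmetric] order.trans)
    qed
    then have "measure (\<nu> l) (Ab l \<inter> h l) = 0"
      unfolding S_def h_def using \<nu>(1) T A trace B_sets
      by (intro measure_hit_at_short_part_eq_0) auto
    moreover have "measure (\<nu> l) (h l) = measure (\<nu> l) (Ab l \<inter> h l) + measure (\<nu> l) (Ao l \<inter> h l)"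
    proof -
      have "h l = (Ab l \<inter> h l) \<union> (Ao l \<inter> h l)"
        using split(1)[of l] sets.sets_into_space[OF h_sets[of l]] by (auto simp: space)
      moreover have "measure (\<nu> l) ((Ab l \<inter> h l) \<union> (Ao l \<inter> h l))
          = measure (\<nu> l) (Ab l \<inter> h l) + measure (\<nu> l) (Ao l \<inter> h l)"
        using split(2)[of l] B_sets[of l] h_sets[of l] by (intro \<nu>.finite_measure_Union) auto
      ultimately show ?thesis by simp
    qed
    moreover have "Q l = measure (\<nu> l) (Ao l \<inter> h l) / measure (\<nu> l) (Ao l)"
      using elim(2) h_sets[of l] by (simp add: Q_def cond_or_zero_def \<nu>.emeasure_eq_measure)
    ultimately have "measure (\<nu> l) (h l) = measure (\<nu> l) (Ao l) * Q l"
      using elim(2) by simp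
    then show ?case using m[of l] by (simp add: field_simps power2_eq_square)
  qed
  have "(\<lambda>l. (measure (\<nu> l) (Ao l) - \<theta>) * (\<theta> * e l)) \<longlonglongrightarrow> 0"
  proof (rule tendsto_0_le[of "\<lambda>l. measure (\<nu> l) (Ao l) - \<theta>" _ _ \<theta>])
    show "(\<lambda>l. measure (\<nu> l) (Ao l) - \<theta>) \<longlonglongrightarrow> 0" using \<theta>_lim by (rule LIM_zero)
    have "e l \<le> 1" "0 \<le> e l" for l using \<theta> m[of l] by (simp_all add: e_def)
    then show "eventually (\<lambda>l. norm ((measure (\<nu> l) (Ao l) - \<theta>) * (\<theta> * e l))
        \<le> norm (measure (\<nu> l) (Ao l) - \<theta>) * \<theta>) sequentially"
      using \<theta> by (intro always_eventually allI) (auto simp: abs_mult intro!: mult_left_mono)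
  qed
  moreover have "(\<lambda>l. measure (\<nu> l) (Ao l) * ((Q l - p l) / m l + (p l / m l - \<theta> * e l))) \<longlonglongrightarrow> \<theta> * (0 + 0)"
    using \<theta>_lim long p unfolding Q_def e_def h_def by (intro tendsto_mult tendsto_add)
  ultimately have "(\<lambda>l. measure (\<nu> l) (Ao l) * ((Q l - p l) / m l + (p l / m l - \<theta> * e l))
        + (measure (\<nu> l) (Ao l) - \<theta>) * (\<theta> * e l)) \<longlonglongrightarrow> \<theta> * (0 + 0) + 0"
    by (intro tendsto_add)
  then have "(\<lambda>l. measure (\<nu> l) (h l) / m l - \<theta>^2 * e l) \<longlonglongrightarrow> \<theta> * (0 + 0) + 0"
    using eq by (rule Lim_transform_eventually)
  then show ?thesis by (simp add: h_def e_def)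
qed

section \<open>From limits along sequences to the four uniform asymptotics\<close>

theorem theorem2p5:
  fixes M :: "'a measure" and T :: "'a \<Rightarrow> 'a" and \<theta> :: real
    and A Ab Ao :: "nat \<Rightarrow> 'a set" and V :: "nat \<Rightarrow> 'a measure set"
  assumes "prob_space M"
    and "measure_preserving_map M T" and "ergodic_map M T"
    and "0 < \<theta>" and "\<theta> \<le> 1"
    and "\<And>l. A l \<in> sets M" and "\<And>l. Ab l \<in> sets M" and "\<And>l. Ao l \<in> sets M"
    and "\<And>l. 0 < measure M (A l)" and "(\<lambda>l. measure M (A l)) \<longlonglongrightarrow> 0"
    and "\<And>l. A l = Ab l \<union> Ao l" and "\<And>l. Ab l \<inter> Ao l = {}"
    and "weak_conv
           (\<lambda>l t. measure M {x \<in> space M.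
              ereal (measure M (A l)) * ereal_of_enat (hitting_time T (A l) x) \<le> ereal t})
           (\<lambda>t. if 0 \<le> t then 1 - exp (- \<theta> * t) else 0)"
    and "\<And>l. V l \<noteq> {}"
    and "\<And>l \<nu>. \<nu> \<in> V l \<Longrightarrow> prob_space \<nu> \<and> sets \<nu> = sets (restrict_space M (A l))"
    and "(\<lambda>l. SUP \<nu>\<in>V l. \<bar>measure \<nu> (Ao l) - \<theta>\<bar>) \<longlonglongrightarrow> 0"
    and "(\<lambda>l. ennreal (measure M (A l)) *
            (SUP \<nu>\<in>V l. esssup (cond_or_zero \<nu> (Ab l))
               (\<lambda>x. indicator (Ab l) x * ennreal_of_enat (hitting_time T (A l) x)))) \<longlonglongrightarrow> 0"
    and "\<And>k. k \<in> time_seqs M A \<Longrightarrow>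
           unif_smallo (Pi UNIV V)
             (\<lambda>\<nu> l. \<bar>measure (cond_or_zero (\<nu> l) (Ao l)) (hit_at (\<nu> l) T (A l) (k l))
                     - measure M (hit_at M T (A l) (k l))\<bar>)
             (\<lambda>\<nu> l. measure M (A l))"
  shows
    "(entrance_closed M T A V V \<longrightarrow>
       (\<forall>d\<ge>1. \<forall>\<delta>\<in>{0<..1}.
          unif_asymp (Pi UNIV V \<times> ({1..d} \<rightarrow> time_seqs_delta M A \<delta>))
            (\<lambda>(\<nu>, k) l. measure (\<nu> l)
               (space (\<nu> l) \<inter> hits_event M T (A l) d (\<lambda>j. k j l)))
            (\<lambda>(\<nu>, k) l. \<theta> ^ (2 * d) * measure M (A l) ^ d
               * exp (- \<theta> * measure M (A l) * (\<Sum>j=1..d. real (k j l))))))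
     \<and>
     (\<forall>d\<ge>1. \<forall>C c.
        entrance_closed M T A V V \<longrightarrow>
        admissible_targets M T A V d C c \<longrightarrow>
        (\<forall>\<delta>\<in>{0<..1}.
          unif_asymp (Pi UNIV V \<times> ({1..d} \<rightarrow> time_seqs_delta M A \<delta>))
            (\<lambda>(\<nu>, k) l. measure (\<nu> l)
               (space (\<nu> l) \<inter> target_hits_event M T (A l) d (\<lambda>j. k j l) (\<lambda>j. C j l)))
            (\<lambda>(\<nu>, k) l. \<theta> ^ (2 * d) * measure M (A l) ^ d * (\<Prod>j=1..d. c j l)
               * exp (- \<theta> * measure M (A l) * (\<Sum>j=1..d. real (k j l))))))
     \<and>
     (\<forall>W.
        entrance_closed M T A V V \<longrightarrow>
        (\<forall>\<nu>\<in>W. prob_space \<nu> \<and> sets \<nu> = sets M) \<longrightarrow>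
        LLT_uniform M T A W \<longrightarrow>
        entrance_closed M T A (\<lambda>l. W) V \<longrightarrow>
        (\<forall>d\<ge>1. \<forall>\<delta>\<in>{0<..1}.
          unif_asymp (W \<times> ({1..d} \<rightarrow> time_seqs_delta M A \<delta>))
            (\<lambda>(\<nu>, k) l. measure \<nu> (hits_event M T (A l) d (\<lambda>j. k j l)))
            (\<lambda>(\<nu>, k) l. \<theta> ^ (2 * d - 1) * measure M (A l) ^ d
               * exp (- \<theta> * measure M (A l) * (\<Sum>j=1..d. real (k j l))))))
     \<and>
     (\<forall>W. \<forall>d\<ge>1. \<forall>C c.
        entrance_closed M T A V V \<longrightarrow>
        admissible_targets M T A V d C c \<longrightarrow>
        (\<forall>\<nu>\<in>W. prob_space \<nu> \<and> sets \<nu> = sets M) \<longrightarrow>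
        LLT_uniform M T A W \<longrightarrow>
        entrance_closed M T A (\<lambda>l. W) V \<longrightarrow>
        entrance_asymp M T A ((\<lambda>\<nu> l. \<nu>) ` W) (C 1) (c 1) \<longrightarrow>
        (\<forall>\<delta>\<in>{0<..1}.
          unif_asymp (W \<times> ({1..d} \<rightarrow> time_seqs_delta M A \<delta>))
            (\<lambda>(\<nu>, k) l. measure \<nu>
               (target_hits_event M T (A l) d (\<lambda>j. k j l) (\<lambda>j. C j l)))
            (\<lambda>(\<nu>, k) l. \<theta> ^ (2 * d - 1) * measure M (A l) ^ d * (\<Prod>j=1..d. c j l)
               * exp (- \<theta> * measure M (A l) * (\<Sum>j=1..d. real (k j l))))))"
proof -
  interpret measure_preserving_system M T
    using assms(1,2) by (simp add: measure_preserving_system_def measure_preserving_system_axioms_def)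
  note A = assms(6) and pos = assms(9) and V_prob = assms(15)
  \<comment> \<open>One rate for all cases: \<open>q\<close> is \<open>\<theta>^2\<close> for
    measures in \<open>V\<close> and \<open>\<theta>\<close> for those in \<open>W\<close>.\<close>
  define h where "h q k l = q * measure M (A l) * exp (- \<theta> * measure M (A l) * real k)"
    for q :: real and k l :: nat
  have h_pos: "0 < h q k l" if "0 < q" for q k l using that pos[of l] by (simp add: h_def)
  have mu_hit: "(\<lambda>l. measure M (hit_at M T (A l) (k l)) / measure M (A l)
            - \<theta> * exp (- \<theta> * measure M (A l) * real (k l))) \<longlonglongrightarrow> 0"
    if "\<delta> \<in> {0<..1}" "k \<in> time_seqs_delta M A \<delta>" for \<delta> k
    using that by (intro hitting_time_local_limit[OF assms(6,9,10,13)]) auto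
  have V_hit: "(\<lambda>l. measure (\<nu> l) (hit_at (\<nu> l) T (A l) (k l)) / h (\<theta>^2) (k l) l) \<longlonglongrightarrow> 1"
    if \<delta>: "\<delta> \<in> {0<..1}" and k: "k \<in> time_seqs_delta M A \<delta>" and \<nu>: "\<nu> \<in> Pi UNIV V" for \<delta> k \<nu>
  proof -
    have \<nu>_V: "\<nu> l \<in> V l" for l using \<nu> by auto
    have K: "k \<in> time_seqs M A" using \<delta> k by (auto simp: time_seqs_def)
    have "(\<lambda>l. \<bar>measure (\<nu> l) (Ao l) - \<theta>\<bar>) \<longlonglongrightarrow> 0"
    proof (rule tendsto_sandwich[OF _ _ tendsto_const assms(16)])
      show "eventually (\<lambda>l. \<bar>measure (\<nu> l) (Ao l) - \<theta>\<bar>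
          \<le> (SUP \<nu>\<in>V l. \<bar>measure \<nu> (Ao l) - \<theta>\<bar>)) sequentially"
      proof (intro always_eventually allI cSUP_upper \<nu>_V bdd_aboveI2)
        fix l \<nu>' assume "\<nu>' \<in> V l"
        then interpret \<nu>': prob_space \<nu>' using V_prob by blast
        \<comment> \<open>A supremum of reals dominates the members only of a bounded set; this is a
          crude bound for the deviations.\<close>
        show "\<bar>measure \<nu>' (Ao l) - \<theta>\<bar> \<le> 1 + \<theta>"
          using \<nu>'.prob_le_1[of "Ao l"] measure_nonneg[of \<nu>' "Ao l"] assms(4) by linarith
      qed
    qed simp
    then have Ao_lim: "(\<lambda>l. measure (\<nu> l) (Ao l)) \<longlonglongrightarrow> \<theta>"
      by (simp add: tendsto_rabs_zero_iff LIM_zero_iff)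
    have short: "(\<lambda>l. ennreal (measure M (A l)) * esssup (cond_or_zero (\<nu> l) (Ab l))
        (\<lambda>x. indicator (Ab l) x * ennreal_of_enat (hitting_time T (A l) x))) \<longlonglongrightarrow> 0"
    proof (rule tendsto_sandwich[OF _ _ tendsto_const assms(17)])
      show "eventually (\<lambda>l. ennreal (measure M (A l)) * esssup (cond_or_zero (\<nu> l) (Ab l))
          (\<lambda>x. indicator (Ab l) x * ennreal_of_enat (hitting_time T (A l) x))
        \<le> ennreal (measure M (A l)) * (SUP \<nu>\<in>V l. esssup (cond_or_zero \<nu> (Ab l))
          (\<lambda>x. indicator (Ab l) x * ennreal_of_enat (hitting_time T (A l) x)))) sequentially"
        by (intro always_eventually allI mult_left_mono SUP_upper \<nu>_V) simp
    qed simp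
    have long: "(\<lambda>l. (measure (cond_or_zero (\<nu> l) (Ao l)) (hit_at (\<nu> l) T (A l) (k l))
          - measure M (hit_at M T (A l) (k l))) / measure M (A l)) \<longlonglongrightarrow> 0"
      using unif_smalloD_sequences[OF assms(18)[OF K], of "\<lambda>_. \<nu>"] \<nu> pos
      by - (rule tendsto_rabs_zero_cancel, simp add: abs_divide)
    have "(\<lambda>l. measure (\<nu> l) (hit_at (\<nu> l) T (A l) (k l)) / measure M (A l)
            - \<theta>^2 * exp (- \<theta> * measure M (A l) * real (k l))) \<longlonglongrightarrow> 0"
    proof (rule return_time_local_limit[OF measurable_T assms(6,7,8,9,11,12)])
      show "prob_space (\<nu> l)" "sets (\<nu> l) = sets (restrict_space M (A l))" for l
        using V_prob[OF \<nu>_V] by blast+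
      show "0 < \<delta>" using \<delta> by simp
      show "\<delta> \<le> measure M (A l) * real (k l)" for l by (rule time_seqs_delta_bounds[OF k])
    qed (fact assms(4) Ao_lim short long mu_hit[OF \<delta> k])+
    then show ?thesis
      unfolding h_def using assms(4) pos
      by (intro ratio_tendsto_1_of_local_limit) (auto intro: time_seqs_delta_bounds[OF k])
  qed
  have W_hit: "(\<lambda>l. measure (\<nu> l) (hit_at (\<nu> l) T (A l) (k l)) / h \<theta> (k l) l) \<longlonglongrightarrow> 1"
    if \<delta>: "\<delta> \<in> {0<..1}" and k: "k \<in> time_seqs_delta M A \<delta>"
      and W: "LLT_uniform M T A W" and \<nu>: "\<And>l. \<nu> l \<in> W" for \<delta> k \<nu> W
  proof -
    have "k \<in> time_seqs M A" using \<delta> k by (auto simp: time_seqs_def)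
    from unif_smalloD_sequences[OF W[unfolded LLT_uniform_def, rule_format, OF this], of \<nu>] \<nu> pos
    have "(\<lambda>l. (measure (\<nu> l) (hit_at (\<nu> l) T (A l) (k l))
          - measure M (hit_at M T (A l) (k l))) / measure M (A l)) \<longlonglongrightarrow> 0"
      by - (rule tendsto_rabs_zero_cancel, simp add: abs_divide)
    from tendsto_add[OF this mu_hit[OF \<delta> k]]
    have "(\<lambda>l. measure (\<nu> l) (hit_at (\<nu> l) T (A l) (k l)) / measure M (A l)
            - \<theta> * exp (- \<theta> * measure M (A l) * real (k l))) \<longlonglongrightarrow> 0"
      by (simp add: diff_divide_distrib)
    then show ?thesis
      unfolding h_def using assms(4) pos
      by (intro ratio_tendsto_1_of_local_limit) (auto intro: time_seqs_delta_bounds[OF k])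
  qed
  have V_family: "entrance_closed_family M T A V" if "entrance_closed M T A V V"
    using that assms(6,14,15) by unfold_locales auto
  have targets: "unif_asymp (Pi UNIV V \<times> ({1..d} \<rightarrow> time_seqs_delta M A \<delta>))
            (\<lambda>(\<nu>, k) l. measure (\<nu> l)
               (space (\<nu> l) \<inter> target_hits_event M T (A l) d (\<lambda>j. k j l) (\<lambda>j. C j l)))
            (\<lambda>(\<nu>, k) l. \<theta> ^ (2 * d) * measure M (A l) ^ d * (\<Prod>j=1..d. c j l)
               * exp (- \<theta> * measure M (A l) * (\<Sum>j=1..d. real (k j l))))"
    if closed: "entrance_closed M T A V V" and C: "admissible_targets M T A V d C c"
      and \<delta>: "\<delta> \<in> {0<..1}" for d C c \<delta>
  proof (rule unif_asympI_sequences)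
    fix x assume x: "\<And>l::nat. x l \<in> Pi UNIV V \<times> ({1..d} \<rightarrow> time_seqs_delta M A \<delta>)"
    \<comment> \<open>At index \<open>l\<close> only the entries at \<open>l\<close> of the chosen
      sequences matter, so they are assembled diagonally into single sequences. Membership in the
      product of the \<open>V l\<close> and in \<open>time_seqs_delta\<close> is a condition on each
      index separately and survives this.\<close>
    define \<nu> where "\<nu> l = fst (x l) l" for l
    define k where "k j l = snd (x l) j l" for j l
    have "\<nu> \<in> Pi UNIV V" using x by (auto simp: \<nu>_def mem_Times_iff Pi_iff)
    moreover have "k \<in> {1..d} \<rightarrow> time_seqs_delta M A \<delta>"
      using x by (fastforce simp: k_def mem_Times_iff Pi_iff time_seqs_delta_def)
    ultimately have "(\<lambda>l. measure (\<nu> l) (space (\<nu> l) \<inter>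
             target_hits_event M T (A l) d (\<lambda>j. k j l) (\<lambda>j. C j l))
           / (\<Prod>j=1..d. h (\<theta>^2) (k j l) l * c j l)) \<longlonglongrightarrow> 1"
      using V_hit[OF \<delta>] h_pos assms(4) \<delta> C
      by (intro entrance_closed_family.target_hits_limit[OF V_family[OF closed]]) auto
    then show "(\<lambda>l. (case x l of (\<nu>, k) \<Rightarrow> \<lambda>l. measure (\<nu> l)
               (space (\<nu> l) \<inter> target_hits_event M T (A l) d (\<lambda>j. k j l) (\<lambda>j. C j l))) l
         / (case x l of (\<nu>, k) \<Rightarrow> \<lambda>l. \<theta> ^ (2 * d) * measure M (A l) ^ d * (\<Prod>j=1..d. c j l)
               * exp (- \<theta> * measure M (A l) * (\<Sum>j=1..d. real (k j l)))) l) \<longlonglongrightarrow> 1"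
      by (simp only: h_def prod_hit_rates \<nu>_def k_def case_prod_beta)
  qed
  have W_targets: "unif_asymp (W \<times> ({1..d} \<rightarrow> time_seqs_delta M A \<delta>))
            (\<lambda>(\<nu>, k) l. measure \<nu> (target_hits_event M T (A l) d (\<lambda>j. k j l) (\<lambda>j. C j l)))
            (\<lambda>(\<nu>, k) l. \<theta> ^ (2 * d - 1) * measure M (A l) ^ d * (\<Prod>j=1..d. c j l)
               * exp (- \<theta> * measure M (A l) * (\<Sum>j=1..d. real (k j l))))"
    if closed: "entrance_closed M T A V V" and C: "admissible_targets M T A V d C c"
      and W: "\<forall>\<nu>\<in>W. prob_space \<nu> \<and> sets \<nu> = sets M" "LLT_uniform M T A W"
        "entrance_closed M T A (\<lambda>l. W) V"
      and C1: "entrance_asymp M T A ((\<lambda>\<nu> l. \<nu>) ` W) (C 1) (c 1)"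
      and \<delta>: "\<delta> \<in> {0<..1}" and d: "1 \<le> d" for W d C c \<delta>
  proof (rule unif_asympI_sequences)
    fix x assume x: "\<And>l::nat. x l \<in> W \<times> ({1..d} \<rightarrow> time_seqs_delta M A \<delta>)"
    \<comment> \<open>In \<open>W\<close> a parameter is a single measure, so the diagonal is taken
      only over the times.\<close>
    define \<nu> where "\<nu> l = fst (x l)" for l
    define k where "k j l = snd (x l) j l" for j l
    have "\<nu> l \<in> W" for l using x[of l] by (auto simp: \<nu>_def mem_Times_iff)
    moreover have k: "k \<in> {1..d} \<rightarrow> time_seqs_delta M A \<delta>"
      using x by (fastforce simp: k_def mem_Times_iff Pi_iff time_seqs_delta_def)
    moreover have "k 1 \<in> time_seqs_delta M A \<delta>" using k d by auto
    ultimately have "(\<lambda>l. measure (\<nu> l) (target_hits_event M T (A l) d (\<lambda>j. k j l) (\<lambda>j. C j l))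
           / (h \<theta> (k 1 l) l * c 1 l * (\<Prod>j=2..d. h (\<theta>^2) (k j l) l * c j l))) \<longlonglongrightarrow> 1"
      using V_hit[OF \<delta>] h_pos assms(4) \<delta> C d W C1 W_hit[OF \<delta> _ W(2)]
      by (intro entrance_closed_family.target_hits_limit_initial[OF V_family[OF closed], where \<delta> = \<delta> and W = W]) auto
    moreover have rate: "h \<theta> (k 1 l) l * c 1 l * (\<Prod>j=2..d. h (\<theta>^2) (k j l) l * c j l)
        = \<theta> ^ (2 * d - 1) * measure M (A l) ^ d * (\<Prod>j=1..d. c j l)
          * exp (- \<theta> * measure M (A l) * (\<Sum>j=1..d. real (k j l)))" for l
      unfolding h_def using assms(4) d by (rule prod_hit_rates_initial)
    ultimately show "(\<lambda>l. (case x l of (\<nu>, k) \<Rightarrow> \<lambda>l. measure \<nu>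
               (target_hits_event M T (A l) d (\<lambda>j. k j l) (\<lambda>j. C j l))) l
         / (case x l of (\<nu>, k) \<Rightarrow> \<lambda>l. \<theta> ^ (2 * d - 1) * measure M (A l) ^ d * (\<Prod>j=1..d. c j l)
               * exp (- \<theta> * measure M (A l) * (\<Sum>j=1..d. real (k j l)))) l) \<longlonglongrightarrow> 1"
      by (simp only: rate[unfolded k_def] \<nu>_def k_def case_prod_beta)
  qed
  have whole: "admissible_targets M T A V d (\<lambda>j. A) (\<lambda>j l. 1)"
    if closed: "entrance_closed M T A V V" for d
  proof (rule entrance_closed_family.admissible_targets_whole[OF V_family[OF closed]])
    fix k \<nu> assume "k \<in> time_seqs M A" and \<nu>: "\<nu> \<in> Pi UNIV V"
    then obtain \<delta> where "\<delta> \<in> {0<..1}" "k \<in> time_seqs_delta M A \<delta>" by (auto simp: time_seqs_def)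
    then show "eventually (\<lambda>l. 0 < measure (\<nu> l) (hit_at (\<nu> l) T (A l) (k l))) sequentially"
      using h_pos assms(4) by (intro eventually_pos_of_ratio_tendsto_1[OF V_hit[OF _ _ \<nu>]]) auto
  qed
  have W_whole: "entrance_asymp M T A ((\<lambda>\<nu> l. \<nu>) ` W) A (\<lambda>l. 1)"
    if closed: "entrance_closed M T A V V"
      and W: "\<forall>\<nu>\<in>W. prob_space \<nu> \<and> sets \<nu> = sets M" "LLT_uniform M T A W" for W
  proof (rule entrance_closed_family.entrance_asymp_whole[OF V_family[OF closed]])
    fix \<nu> :: "nat \<Rightarrow> 'a measure" and l assume "\<nu> \<in> (\<lambda>\<nu> l. \<nu>) ` W"
    then have \<nu>: "prob_space (\<nu> l)" "sets (\<nu> l) = sets M" using W(1) by auto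
    then show "prob_space (\<nu> l) \<and> space (\<nu> l) \<in> sets M \<and>
        sets (\<nu> l) = sets (restrict_space M (space (\<nu> l)))"
      using sets_eq_imp_space_eq[OF \<nu>(2)] by (simp add: sets_restrict_space_space)
  next
    fix k and x :: "nat \<Rightarrow> nat \<Rightarrow> 'a measure"
    assume "k \<in> time_seqs M A" and "\<And>l. x l \<in> (\<lambda>\<nu> l. \<nu>) ` W"
    then have x: "x l l \<in> W" for l by (metis imageE)
    obtain \<delta> where "\<delta> \<in> {0<..1}" "k \<in> time_seqs_delta M A \<delta>"
      using \<open>k \<in> time_seqs M A\<close> by (auto simp: time_seqs_def)
    then show "eventually (\<lambda>l. 0 < measure (x l l) (hit_at (x l l) T (A l) (k l))) sequentially"
      using h_pos assms(4)
      by (intro eventually_pos_of_ratio_tendsto_1[OF W_hit[OF _ _ W(2) x]]) auto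
  qed
  \<comment> \<open>With the targets \<open>A\<close> every factor \<open>c j l\<close> is 1, so
    that their product disappears and the statements without targets remain.\<close>
  note hits = targets[OF _ whole, unfolded prod.neutral_const mult_1_right]
  note W_hits = W_targets[OF _ whole _ _ _ W_whole, unfolded prod.neutral_const mult_1_right]
  show ?thesis
    unfolding hits_event_eq_target_hits_event
    by (intro conjI allI impI ballI) (assumption | rule hits W_hits targets W_targets)+
qed

end
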